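(* For every constant $c>0$ there is $p_0=p_0(c)$ such that the following holds for every prime $p\geqslant p_0$: every subset $A\subseteq \mathbb{F}_p\setminus\{0\}$ of size $|A|\leqslant e^{c(\log p)^{1/4}}$ has a valid ordering.
   Context: For a finite subset $A$ of an abelian group, an ordering $a_1,\ldots,a_{|A|}$ of $A$ is called valid if the partial sums $a_1,\ a_1+a_2,\ \ldots,\ a_1+a_2+\cdots+a_{|A|}$ are pairwise distinct. $\mathbb{F}_p$ denotes the field with $p$ elements. *)

theory Defs
  imports Complex_Main "HOL-Number_Theory.Residues"
begin

text \<open>
  Following the HOL-Algebra convention for additively written abelian groups
  (\<^locale>\<open>abelian_group\<close>), the group is the additive part of a ring record.
\<close>

definition partial_sum :: "('a, 'b) ring_scheme \<Rightarrow> 'a list \<Rightarrow> nat \<Rightarrow> 'a" where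
  "partial_sum G xs k = (\<Oplus>\<^bsub>G\<^esub>i\<in>{..<k}. xs ! i)"

text \<open>
  Only the sums of the nonempty prefixes have to be pairwise distinct; the empty sum
  is not among them, so one of the listed partial sums may be zero.
\<close>

definition valid_ordering :: "('a, 'b) ring_scheme \<Rightarrow> 'a set \<Rightarrow> 'a list \<Rightarrow> bool" where
  "valid_ordering G A xs \<longleftrightarrow>
     distinct xs \<and> set xs = A \<and> inj_on (partial_sum G xs) {1..length xs}"

end

theory Submission
  imports Defs "HOL-Combinatorics.Multiset_Permutations" "HOL-Real_Asymp.Real_Asymp"
begin

text \<open>
  Split \<open>A\<close> into a set \<open>E\<close> of dimension less than \<open>R = O(log |A|)\<close>, contained in the combinations with
  coefficients \<open>-1, 0, 1\<close> of fewer than \<open>R\<close> elements, and dissociated blocks \<open>D\<^sub>0, \<dots>, D\<^sub>s\<^sub>-\<^sub>1\<close> of size \<open>R\<close>.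
  A set in a box on \<open>O(R)\<close> generators can be dilated into a short interval and then behaves like a set of
  integers, for which an ordering is found greedily. So assume that \<open>A\<close> is in no such box.

  The ordering is \<open>x, E, b, w\<close>, where no interval starting at \<open>x\<close> matters and \<open>w\<close> runs first through a part
  of every block and then through the remaining part of every block. An interval of \<open>w\<close> (or a suffix of \<open>E, b\<close>
  with a prefix of \<open>w\<close>) either contains a middling number of elements of some block, so that by
  dissociativity a random ordering of that block gives a zero sum with probability below a large power
  of \<open>1 / |A|\<close>, or consists of (or misses only) a few elements around a junction of two parts. The junctions are
  controlled by restricting the few elements around them, which costs only a factor \<open>2\<^sup>O\<^sup>(\<^sup>K\<^sup>)\<close>, \<open>K = O(log |A|)\<close>,
  in the probabilities. At both ends of \<open>w\<close> the elements \<open>b\<close> and \<open>x\<close> are chosen to keep the sums away from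
  the box containing the sums of \<open>E\<close>; if that were impossible, \<open>A\<close> would lie in a box on few generators.
\<close>

section \<open>Orderings of integer sets\<close>

text \<open>Validity compares nonempty prefixes only, so an interval that begins at the first
  element is unconstrained; this frees \<open>x\<close> to be chosen for the sake of the far end of
  \<open>w\<close>. The obstacle behind the two rounds through the blocks is that a block lying
  wholly inside an interval contributes a fixed sum, whatever its ordering. With the two parts of a
  block \<open>s\<close> pieces apart, an interval that spans several parts contains one without its
  partner, unless it runs from the first part to the last. The exponents form a budget: with
  \<open>K\<close> about log2 of \<open>card A\<close> there are fewer than 2^(4K) events,
  controlling \<open>K\<close> elements at each of the four ends in a block costs at most 2^(16K),
  and a block of size about 2^21 K gives each event probability at most 2^(-20K). Rectification on
  2^22 K generators with Q = 2^(26K) needs 2^(26 * 2^22 * K^2) < p, so K^2 must be small against log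
  p; here it is O((log p)^(1/2)).\<close>

definition prefix_sums_disjoint :: "int list \<Rightarrow> int list \<Rightarrow> bool" where
  "prefix_sums_disjoint ps ns \<longleftrightarrow>
     (\<forall>i\<in>{1..length ps}. \<forall>j\<in>{1..length ns}. sum_list (take i ps) \<noteq> sum_list (take j ns))"

lemma prefix_sums_disjointD:
  assumes "prefix_sums_disjoint ps ns" "ps = p1 @ p2" "ns = n1 @ n2" "p1 \<noteq> []" "n1 \<noteq> []"
  shows "sum_list p1 \<noteq> sum_list n1"
proof -
  have "length p1 \<in> {1..length ps}" "length n1 \<in> {1..length ns}"
    using assms(2-5) by (auto simp: Suc_le_eq)
  then have "sum_list (take (length p1) ps) \<noteq> sum_list (take (length n1) ns)"
    using assms(1) unfolding prefix_sums_disjoint_def by blast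
  then show ?thesis using assms(2,3) by simp
qed

lemma prefix_sums_disjointI:
  assumes "\<And>p1 p2 n1 n2. ps = p1 @ p2 \<Longrightarrow> ns = n1 @ n2 \<Longrightarrow> p1 \<noteq> [] \<Longrightarrow> n1 \<noteq> [] \<Longrightarrow> sum_list p1 \<noteq> sum_list n1"
  shows "prefix_sums_disjoint ps ns"
  unfolding prefix_sums_disjoint_def
proof (intro ballI)
  fix i j assume "i \<in> {1..length ps}" "j \<in> {1..length ns}"
  then have "take i ps \<noteq> []" "take j ns \<noteq> []" by auto
  then show "sum_list (take i ps) \<noteq> sum_list (take j ns)"
    by (intro assms[of "take i ps" "drop i ps" "take j ns" "drop j ns"]) simp_all
qed

lemma prefix_sums_disjoint_sym: "prefix_sums_disjoint ps ns \<Longrightarrow> prefix_sums_disjoint ns ps"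
  unfolding prefix_sums_disjoint_def by (intro ballI) (rule not_sym, blast)

text \<open>Put last an element \<open>x\<close> of the set with the larger total: the full sum then
  exceeds every prefix sum of the other side, and the rest is the induction hypothesis. Its totals
  must differ again; of two candidates for \<open>x\<close> at least one leaves a different
  total.\<close>

lemma zip_order_distinct_totals:
  fixes P N :: "int set"
  assumes "finite P" "finite N" "\<forall>x\<in>P. x > 0" "\<forall>x\<in>N. x > 0" "\<Sum>P \<noteq> \<Sum>N"
  shows "\<exists>ps ns. distinct ps \<and> set ps = P \<and> distinct ns \<and> set ns = N \<and>
    prefix_sums_disjoint ps ns"
  using assms
proof (induction "card P + card N" arbitrary: P N rule: less_induct)
  case less
  \<comment> \<open>The induction hypothesis enters as an assumption so that one argument serves
    both signs of the difference of the totals.\<close>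
  have main: "\<exists>ps ns. distinct ps \<and> set ps = P \<and> distinct ns \<and> set ns = N \<and>
    prefix_sums_disjoint ps ns"
    if fin: "finite P" "finite N" and pos: "\<forall>x\<in>P. x > 0" "\<forall>x\<in>N. x > 0" and gt: "\<Sum>P > \<Sum>N"
      and IH: "\<And>P'. P' \<subset> P \<Longrightarrow> \<Sum>P' \<noteq> \<Sum>N \<Longrightarrow>
        \<exists>ps ns. distinct ps \<and> set ps = P' \<and> distinct ns \<and> set ns = N \<and>
        prefix_sums_disjoint ps ns"
    for P N :: "int set"
  proof -
    have prefix_le: "sum_list n1 \<le> \<Sum>N" if "set (n1 @ n2) = N" "distinct (n1 @ n2)" for n1 n2
    proof -
      have "sum_list n1 = \<Sum>(set n1)"
        using that by (simp add: distinct_sum_list_conv_Sum)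
      also have "\<dots> \<le> \<Sum>N"
        using that fin pos by (intro sum_mono2) (auto intro: less_imp_le)
      finally show ?thesis .
    qed
    have "P \<noteq> {}"
      using gt sum_nonneg[of N "\<lambda>x. x"] pos(2) by (auto simp: less_imp_le)
    then obtain x0 where x0: "x0 \<in> P" by blast
    show ?thesis
    proof (cases "P = {x0}")
      case True
      obtain ns where ns: "set ns = N" "distinct ns" using finite_distinct_list fin by blast
      have "prefix_sums_disjoint [x0] ns"
      proof (rule prefix_sums_disjointI)
        fix p1 p2 n1 n2 :: "int list"
        assume *: "[x0] = p1 @ p2" "ns = n1 @ n2" "p1 \<noteq> []"
        then have "p1 = [x0]" by (cases p1) simp_all
        moreover have "sum_list n1 \<le> \<Sum>N" using prefix_le[of n1 n2] ns *(2) by simp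
        ultimately show "sum_list p1 \<noteq> sum_list n1" using gt True by simp
      qed
      moreover have "distinct [x0]" "set [x0] = P" using True by auto
      ultimately show ?thesis using ns by blast
    next
      case False
      then obtain x1 where x1: "x1 \<in> P" "x1 \<noteq> x0" using x0 by blast
      obtain x where x: "x \<in> P" "\<Sum>(P - {x}) \<noteq> \<Sum>N"
      proof (cases "\<Sum>(P - {x0}) = \<Sum>N")
        case True
        have "\<Sum>(P - {x0}) = \<Sum>P - x0" "\<Sum>(P - {x1}) = \<Sum>P - x1"
          using x0 x1 fin by (auto simp: sum_diff1)
        with True x1 that[of x1] show ?thesis by auto
      qed (use x0 that in blast)
      from IH[of "P - {x}"] x obtain ps ns where o: "distinct ps" "set ps = P - {x}" "distinct ns" "set ns = N"
        "prefix_sums_disjoint ps ns"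
        by blast
      have "sum_list p1 \<noteq> sum_list n1" if "ps @ [x] = p1 @ p2" "ns = n1 @ n2" "p1 \<noteq> []" "n1 \<noteq> []" for p1 p2 n1 n2
      proof (cases "p2 = []")
        case True
        then have "p1 = ps @ [x]" using that(1) by simp
        then have "sum_list p1 = \<Sum>P"
          using o(1,2) distinct_sum_list_conv_Sum[OF o(1)] sum.remove[of P x "\<lambda>x. x"] x(1) fin(1)
          by simp
        then show ?thesis using prefix_le[of n1 n2] that o gt by auto
      next
        case False
        then have "ps = p1 @ butlast p2"
          using arg_cong[OF that(1), of butlast] by (simp add: butlast_append)
        then show ?thesis using prefix_sums_disjointD[OF o(5)] that by blast
      qed
      then have "prefix_sums_disjoint (ps @ [x]) ns"
        by (rule prefix_sums_disjointI)
      moreover have "distinct (ps @ [x])" "set (ps @ [x]) = P"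
        using o(1,2) x by auto
      ultimately show ?thesis using o(3,4) by blast
    qed
  qed
  show ?case
  proof (cases "\<Sum>P > \<Sum>N")
    case True
    show ?thesis
    proof (rule main[OF less.prems(1-4) True])
      fix P' assume P': "P' \<subset> P" "\<Sum>P' \<noteq> \<Sum>N"
      have "finite P'" "card P' + card N < card P + card N"
        using P' less.prems(1) by (auto intro: finite_subset psubset_card_mono)
      moreover have "\<forall>x\<in>P'. x > 0" using P' less.prems(3) by blast
      ultimately show "\<exists>ps ns. distinct ps \<and> set ps = P' \<and> distinct ns \<and> set ns = N \<and>
        prefix_sums_disjoint ps ns"
        using P'(2) less.prems(2,4) by (intro less.hyps) simp_all
    qed
  next
    case False
    then have "\<Sum>N > \<Sum>P" using less.prems by auto
    have "\<exists>ns ps. distinct ns \<and> set ns = N \<and> distinct ps \<and> set ps = P \<and> prefix_sums_disjoint ns ps"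
    proof (rule main[OF less.prems(2,1,4,3) \<open>\<Sum>N > \<Sum>P\<close>])
      fix N' assume N': "N' \<subset> N" "\<Sum>N' \<noteq> \<Sum>P"
      have "finite N'" "card N' + card P < card P + card N"
        using N' less.prems(2) by (auto intro: finite_subset psubset_card_mono)
      moreover have "\<forall>x\<in>N'. x > 0" using N' less.prems(4) by blast
      ultimately show "\<exists>ps ns. distinct ps \<and> set ps = N' \<and> distinct ns \<and> set ns = P \<and> prefix_sums_disjoint ps ns"
        using N'(2) less.prems(1,3) by (intro less.hyps) simp_all
    qed
    then obtain ns ps where o: "distinct ps" "set ps = P" "distinct ns" "set ns = N" "prefix_sums_disjoint ns ps"
      by blast
    show ?thesis
      by (rule exI[of _ ps], rule exI[of _ ns]) (use o prefix_sums_disjoint_sym[OF o(5)] in simp)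
  qed
qed

text \<open>Equal totals force the two full sums to coincide, so only that pair is exempt. Removing
  \<open>x\<close> makes the totals differ; \<open>x\<close> returns at the end, where the full sum
  equals the total of \<open>N\<close> and so exceeds every proper prefix sum of
  \<open>N\<close>.\<close>

lemma zip_order:
  fixes P N :: "int set"
  assumes "finite P" "finite N" "\<forall>x\<in>P. x > 0" "\<forall>x\<in>N. x > 0"
  shows "\<exists>ps ns. distinct ps \<and> set ps = P \<and> distinct ns \<and> set ns = N \<and>
    (\<forall>p1 p2 n1 n2. ps = p1 @ p2 \<longrightarrow> ns = n1 @ n2 \<longrightarrow> p1 \<noteq> [] \<longrightarrow> n1 \<noteq> [] \<longrightarrow> p2 \<noteq> [] \<or> n2 \<noteq> [] \<longrightarrow>
      sum_list p1 \<noteq> sum_list n1)"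
proof (cases "\<Sum>P = \<Sum>N \<and> P \<noteq> {}")
  case False
  show ?thesis
  proof (cases "P = {}")
    case True
    moreover obtain ns where "set ns = N" "distinct ns" using finite_distinct_list[OF assms(2)] by blast
    ultimately show ?thesis by (intro exI[of _ "[]"] exI[of _ ns]) simp
  next
    case False
    then have "\<Sum>P \<noteq> \<Sum>N" using \<open>\<not> (\<Sum>P = \<Sum>N \<and> P \<noteq> {})\<close> by blast
    from zip_order_distinct_totals[OF assms this] obtain ps ns where o: "distinct ps" "set ps = P"
      "distinct ns" "set ns = N" "prefix_sums_disjoint ps ns"
      by (elim exE conjE)
    then show ?thesis
      by (intro exI[of _ ps] exI[of _ ns] conjI allI impI) (simp_all add: prefix_sums_disjointD)
  qed
next
  case True
  then obtain x where x: "x \<in> P" by blast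
  have "\<Sum>(P - {x}) = \<Sum>P - x" using x assms by (simp add: sum_diff1)
  then have ne: "\<Sum>(P - {x}) \<noteq> \<Sum>N" using True x assms by force
  obtain ps ns where o: "distinct ps" "set ps = P - {x}" "distinct ns" "set ns = N"
        "prefix_sums_disjoint ps ns"
    using zip_order_distinct_totals[of "P - {x}" N] assms ne by blast
  have "sum_list p1 \<noteq> sum_list n1"
    if "ps @ [x] = p1 @ p2" "ns = n1 @ n2" "p1 \<noteq> []" "n1 \<noteq> []" "p2 \<noteq> [] \<or> n2 \<noteq> []" for p1 p2 n1 n2
  proof (cases "p2 = []")
    case pT: True
    then have p: "p1 = ps @ [x]" using that by auto
    have "sum_list p1 = \<Sum>P"
      using o(1,2) x assms(1) by (simp add: p distinct_sum_list_conv_Sum sum.remove)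
    moreover have "\<Sum>N = sum_list n1 + sum_list n2"
      using that(2) o(3,4) distinct_sum_list_conv_Sum[OF o(3)] by simp
    moreover have "sum_list n2 > 0"
    proof -
      have "sum_list n2 = \<Sum>(set n2)" using that o by (simp add: distinct_sum_list_conv_Sum)
      also have "\<dots> > 0" using that o pT assms by (intro sum_pos) auto
      finally show ?thesis .
    qed
    ultimately show ?thesis using True by simp
  next
    case False
    then have "ps = p1 @ butlast p2"
      using arg_cong[OF that(1), of butlast] by (simp add: butlast_append)
    then show ?thesis using prefix_sums_disjointD[OF o(5)] that by blast
  qed
  moreover have "distinct (ps @ [x])" "set (ps @ [x]) = P"
    using o(1,2) x by auto
  ultimately show ?thesis using o(3,4)
    by (intro exI[of _ "ps @ [x]"] exI[of _ ns] conjI allI impI) simp_all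
qed

lemma sum_list_positive:
  fixes xs :: "int list"
  assumes "xs \<noteq> []" "\<forall>x\<in>set xs. x > 0"
  shows "sum_list xs > 0"
  using assms by (induction xs rule: list_nonempty_induct) auto

text \<open>Positives in reverse, then negatives: an interval on one side has a definite sign, and
  one across the junction sets a prefix of \<open>ps\<close> against a prefix of \<open>ns\<close>.
  Only the whole list may sum to zero, hence the condition \<open>u @ w \<noteq> []\<close>.\<close>

lemma integer_order:
  fixes A :: "int set"
  assumes "finite A" "0 \<notin> A"
  shows "\<exists>xs. distinct xs \<and> set xs = A \<and>
    (\<forall>u v w. xs = u @ v @ w \<longrightarrow> v \<noteq> [] \<longrightarrow> u @ w \<noteq> [] \<longrightarrow> sum_list v \<noteq> 0)"
proof -
  define P N where "P = {x\<in>A. x > 0}" and "N = uminus ` {x\<in>A. x < 0}"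
  obtain ps ns where o: "distinct ps" "set ps = P" "distinct ns" "set ns = N" and
    z: "\<And>p1 p2 n1 n2. ps = p1 @ p2 \<Longrightarrow> ns = n1 @ n2 \<Longrightarrow> p1 \<noteq> [] \<Longrightarrow> n1 \<noteq> [] \<Longrightarrow> p2 \<noteq> [] \<or> n2 \<noteq> [] \<Longrightarrow>
      sum_list p1 \<noteq> sum_list n1"
  proof -
    have "finite P" "finite N" "\<forall>x\<in>P. x > 0" "\<forall>x\<in>N. x > 0"
      using assms by (auto simp: P_def N_def)
    from zip_order[OF this] obtain ps ns where "distinct ps" "set ps = P" "distinct ns" "set ns = N"
      "\<forall>p1 p2 n1 n2. ps = p1 @ p2 \<longrightarrow> ns = n1 @ n2 \<longrightarrow> p1 \<noteq> [] \<longrightarrow> n1 \<noteq> [] \<longrightarrow> p2 \<noteq> [] \<or> n2 \<noteq> [] \<longrightarrow>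
        sum_list p1 \<noteq> sum_list n1"
      by (elim exE conjE)
    then show ?thesis by (intro that[of ps ns]) simp_all
  qed
  define xs where "xs = rev ps @ map uminus ns"
  have setn: "uminus ` N = {x\<in>A. x < 0}" by (auto simp: N_def image_image)
  have um: "sum_list (map uminus l) = - sum_list l" for l :: "int list"
    by (induction l) auto
  have neg: "sum_list (map uminus l) < 0" if "l \<noteq> []" "\<forall>x\<in>set l. x > 0" for l :: "int list"
    using sum_list_positive[OF that] um by auto
  have revsum: "sum_list (rev l) = sum_list l" for l :: "int list" by (induction l) auto
  have "sum_list v \<noteq> 0" if v: "xs = u @ v @ w" "v \<noteq> []" "u @ w \<noteq> []" for u v w
  proof -
    have Pp: "\<forall>x\<in>set ps. x > 0" and Np: "\<forall>x\<in>set ns. x > 0" using o by (auto simp: P_def N_def)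
    from v(1) have "rev ps @ map uminus ns = u @ v @ w" by (simp add: xs_def)
    then consider us where "u = rev ps @ us" "map uminus ns = us @ v @ w"
      | us where "rev ps = u @ us" "us @ map uminus ns = v @ w"
      by (auto simp: append_eq_append_conv2)
    then show ?thesis
    proof cases
      case 1
      then obtain us' vs where "ns = us' @ vs" "v @ w = map uminus vs"
        by (auto simp: map_eq_append_conv)
      then obtain l l' where "ns = us' @ l @ l'" "v = map uminus l"
        by (auto simp: append_eq_map_conv)
      then have "l \<noteq> []" "\<forall>x\<in>set l. x > 0" using v(2) Np by simp_all
      then show ?thesis using neg[of l] \<open>v = map uminus l\<close> by simp
    next
      case 2
      then consider vs where "us = v @ vs" | vs where "v = us @ vs" "map uminus ns = vs @ w"
        by (auto simp: append_eq_append_conv2)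
      then show ?thesis
      proof cases
        case 1
        then have "set v \<subseteq> set ps" using arg_cong[OF 2(1), of set] by auto
        then have "\<forall>x\<in>set v. x > 0" using Pp by blast
        then show ?thesis using sum_list_positive[of v] v(2) by simp
      next
        case b: 2
        then obtain n1 n2 where n: "ns = n1 @ n2" "vs = map uminus n1" "w = map uminus n2"
          by (auto simp: map_eq_append_conv)
        have p: "ps = rev us @ rev u" using arg_cong[OF 2(1), of rev] by simp
        show ?thesis
        proof (cases "us = [] \<or> n1 = []")
          case True
          then show ?thesis
          proof
            assume "us = []"
            then have "v = map uminus n1" "n1 \<noteq> []" "\<forall>x\<in>set n1. x > 0" using b(1) n(1,2) v(2) Np by simp_all
            then show ?thesis using neg[of n1] by simp
          next
            assume "n1 = []"
            then have "v = us" "\<forall>x\<in>set us. x > 0" using b(1) n(2) p Pp by simp_all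
            then show ?thesis using sum_list_positive[of v] v(2) by simp
          qed
        next
          case False
          have "rev u \<noteq> [] \<or> n2 \<noteq> []" using v(3) n(3) by simp
          then have "sum_list (rev us) \<noteq> sum_list n1"
            using z[OF p n(1)] False by simp
          then show ?thesis using um[of n1] unfolding b(1) n(2) by (simp add: revsum)
        qed
      qed
    qed
  qed
  moreover have "distinct xs"
    using o setn by (auto simp: xs_def distinct_map P_def)
  moreover have "set xs = A"
  proof -
    have "set xs = P \<union> {x\<in>A. x < 0}" using o setn by (simp add: xs_def)
    also have "\<dots> = A" using assms(2) by (auto simp: P_def) (metis linorder_neqE)
    finally show ?thesis .
  qed
  ultimately show ?thesis by blast
qed

section \<open>Boxes and rectification\<close>

text \<open>A generalized arithmetic progression centred at zero, with generators \<open>B\<close>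
  and coefficient bound \<open>M\<close>, saturated under congruence modulo
  \<open>m\<close>.\<close>

definition box :: "int \<Rightarrow> int set \<Rightarrow> int \<Rightarrow> int set" where
  "box m B M = {v. \<exists>\<beta>. (\<forall>b\<in>B. \<bar>\<beta> b\<bar> \<le> M) \<and> [v = (\<Sum>b\<in>B. \<beta> b * b)] (mod m)}"

lemma box_cong: "v \<in> box m B M \<Longrightarrow> [v = w] (mod m) \<Longrightarrow> w \<in> box m B M"
  unfolding box_def using cong_trans cong_sym by blast

lemma box_zero: "M \<ge> 0 \<Longrightarrow> 0 \<in> box m B M"
  unfolding box_def by (auto intro!: exI[of _ "\<lambda>_. 0"])

lemma box_add:
  assumes "v \<in> box m B M" "w \<in> box m B M'"
  shows "v + w \<in> box m B (M + M')"
proof -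
  obtain \<beta> \<gamma> where "\<forall>b\<in>B. \<bar>\<beta> b\<bar> \<le> M" "[v = (\<Sum>b\<in>B. \<beta> b * b)] (mod m)"
    "\<forall>b\<in>B. \<bar>\<gamma> b\<bar> \<le> M'" "[w = (\<Sum>b\<in>B. \<gamma> b * b)] (mod m)"
    using assms unfolding box_def by blast
  moreover from this have "[v + w = (\<Sum>b\<in>B. (\<beta> b + \<gamma> b) * b)] (mod m)"
    using cong_add by (fastforce simp: algebra_simps sum.distrib)
  moreover have "\<bar>\<beta> b + \<gamma> b\<bar> \<le> M + M'" if "b \<in> B" for b
    using calculation that abs_triangle_ineq[of "\<beta> b" "\<gamma> b"] by fastforce
  ultimately show ?thesis
    unfolding box_def by (intro CollectI exI[of _ "\<lambda>b. \<beta> b + \<gamma> b"] conjI ballI) simp_all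
qed

lemma box_scale:
  assumes "v \<in> box m B M" "k \<ge> 0"
  shows "k * v \<in> box m B (k * M)"
proof -
  obtain \<beta> where b: "\<forall>b\<in>B. \<bar>\<beta> b\<bar> \<le> M" "[v = (\<Sum>b\<in>B. \<beta> b * b)] (mod m)"
    using assms unfolding box_def by blast
  have "[k * v = (\<Sum>b\<in>B. (k * \<beta> b) * b)] (mod m)"
    using cong_scalar_left[OF b(2), of k] by (simp add: sum_distrib_left algebra_simps)
  moreover have "\<bar>k * \<beta> b\<bar> \<le> k * M" if "b \<in> B" for b
    using b(1) that assms(2) by (simp add: abs_mult mult_left_mono)
  ultimately show ?thesis
    unfolding box_def by (intro CollectI exI[of _ "\<lambda>b. k * \<beta> b"] conjI ballI) simp_all
qed

lemma box_uminus:
  assumes "v \<in> box m B M"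
  shows "- v \<in> box m B M"
proof -
  obtain \<beta> where b: "\<forall>b\<in>B. \<bar>\<beta> b\<bar> \<le> M" "[v = (\<Sum>b\<in>B. \<beta> b * b)] (mod m)"
    using assms unfolding box_def by blast
  have "[- v = (\<Sum>b\<in>B. (- \<beta> b) * b)] (mod m)"
    using b(2) by (simp add: sum_negf cong_minus_minus_iff)
  then show ?thesis
    unfolding box_def using b(1) by (intro CollectI exI[of _ "\<lambda>b. - \<beta> b"] conjI ballI) simp_all
qed

lemma box_diff: "v \<in> box m B M \<Longrightarrow> w \<in> box m B M' \<Longrightarrow> v - w \<in> box m B (M + M')"
  using box_add[of v m B M "- w" M'] box_uminus[of w m B M'] by simp

lemma box_mono:
  assumes "finite B'" "B \<subseteq> B'" "M \<le> M'" "0 \<le> M'"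
  shows "box m B M \<subseteq> box m B' M'"
proof
  fix v assume "v \<in> box m B M"
  then obtain \<beta> where b: "\<forall>b\<in>B. \<bar>\<beta> b\<bar> \<le> M" "[v = (\<Sum>b\<in>B. \<beta> b * b)] (mod m)"
    unfolding box_def by blast
  define \<gamma> where "\<gamma> = (\<lambda>b. if b \<in> B then \<beta> b else 0)"
  have "(\<Sum>b\<in>B. \<beta> b * b) = (\<Sum>b\<in>B'. \<gamma> b * b)"
    using assms(1,2) by (intro sum.mono_neutral_cong_left) (auto simp: \<gamma>_def)
  moreover have "\<forall>b\<in>B'. \<bar>\<gamma> b\<bar> \<le> M'" using b(1) assms by (auto simp: \<gamma>_def)
  ultimately show "v \<in> box m B' M'"
    unfolding box_def using b(2) by auto
qed

lemma box_base:
  assumes "finite B" "b \<in> B" "M \<ge> 1"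
  shows "b \<in> box m B M"
proof -
  have "(\<Sum>c\<in>B. (if c = b then 1 else 0) * c) = (\<Sum>c\<in>{b}. c)"
    using assms(1,2) by (intro sum.mono_neutral_cong_right) auto
  then show ?thesis
    unfolding box_def using assms(3) by (intro CollectI exI[of _ "\<lambda>c. if c = b then 1 else 0"] conjI ballI) simp_all
qed

lemma box_sum:
  assumes "finite S" "\<And>x. x \<in> S \<Longrightarrow> f x \<in> box m B M"
  shows "sum f S \<in> box m B (int (card S) * M)"
  using assms
proof (induction S rule: finite_induct)
  case empty
  then show ?case by (simp add: box_zero)
next
  case (insert x S)
  have "f x + sum f S \<in> box m B (M + int (card S) * M)"
    using insert by (intro box_add) auto
  then show ?case using insert.hyps by (simp add: algebra_simps)
qed

text \<open>Dirichlet's simultaneous approximation.\<close>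

lemma dilate_to_small:
  fixes B :: "int set" and p Q :: int
  assumes "finite B" "p > 0" "Q > 0" "Q ^ card B < p"
  obtains l r where "0 < l" "l < p" "\<And>b. b \<in> B \<Longrightarrow> [l * b = r b] (mod p)" "\<And>b. b \<in> B \<Longrightarrow> Q * \<bar>r b\<bar> \<le> p"
proof -
  \<comment> \<open>Each coordinate records in which of \<open>Q\<close> equal cells the residue of
    \<open>l * b\<close> lies. As \<open>Q ^ card B < p\<close>, two of the \<open>p\<close> dilates
    share all cells, and their difference is the required \<open>l\<close>.\<close>
  define g where "g = (\<lambda>l. \<lambda>b\<in>B. (Q * ((l * b) mod p)) div p)"
  have "(Q * (x mod p)) div p \<in> {0..<Q}" for x
  proof -
    have "0 \<le> x mod p" "x mod p < p" using assms(2) by simp_all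
    then have "0 \<le> Q * (x mod p)" "Q * (x mod p) < Q * p" using assms(3) by simp_all
    moreover have "Q * (x mod p) div p * p \<le> Q * (x mod p)"
      using div_mult_mod_eq[of "Q * (x mod p)" p] pos_mod_sign[OF assms(2), of "Q * (x mod p)"] by linarith
    ultimately have "Q * (x mod p) div p * p < Q * p" by linarith
    then have "Q * (x mod p) div p < Q" using assms(2) by simp
    moreover have "0 \<le> Q * (x mod p) div p"
      using \<open>0 \<le> Q * (x mod p)\<close> assms(2) by (simp add: pos_imp_zdiv_nonneg_iff)
    ultimately show ?thesis by simp
  qed
  then have "g l \<in> B \<rightarrow>\<^sub>E {0..<Q}" for l
    by (simp add: g_def)
  then have "g ` {0..<p} \<subseteq> B \<rightarrow>\<^sub>E {0..<Q}" by blast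
  moreover have "finite (B \<rightarrow>\<^sub>E {0..<Q})" using assms by (intro finite_PiE) auto
  ultimately have "card (g ` {0..<p}) \<le> card (B \<rightarrow>\<^sub>E {0..<Q})" by (rule card_mono[rotated])
  also have "\<dots> = nat Q ^ card B" using assms by (simp add: card_funcsetE)
  also have "\<dots> < card {0..<p}" using assms by (simp add: nat_power_eq[symmetric] nat_less_eq_zless)
  finally have "\<not> inj_on g {0..<p}" using card_image by fastforce
  then obtain l1 l2 where l: "l1 \<in> {0..<p}" "l2 \<in> {0..<p}" "l1 < l2" "g l1 = g l2"
    unfolding inj_on_def by (metis linorder_neqE)
  show ?thesis
  proof
    show "0 < l2 - l1" "l2 - l1 < p" using l by auto
    fix b assume b: "b \<in> B"
    show "[(l2 - l1) * b = (l2 * b) mod p - (l1 * b) mod p] (mod p)"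
      by (simp add: Cong.cong_def mod_diff_eq left_diff_distrib)
    define x y where "x = (l2 * b) mod p" and "y = (l1 * b) mod p"
    have "(Q * x) div p = (Q * y) div p"
      using fun_cong[OF l(4), of b] b by (simp add: g_def x_def y_def)
    then have "(Q * x) div p * p = (Q * y) div p * p" by simp
    then have "Q * x - Q * y = (Q * x) mod p - (Q * y) mod p"
      using div_mult_mod_eq[of "Q * x" p] div_mult_mod_eq[of "Q * y" p] by linarith
    then have "\<bar>Q * x - Q * y\<bar> \<le> p"
      using pos_mod_bound[OF assms(2), of "Q * x"] pos_mod_bound[OF assms(2), of "Q * y"]
        pos_mod_sign[OF assms(2), of "Q * x"] pos_mod_sign[OF assms(2), of "Q * y"] by linarith
    then show "Q * \<bar>(l2 * b) mod p - (l1 * b) mod p\<bar> \<le> p"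
      using assms(3) by (simp add: x_def y_def right_diff_distrib[symmetric] abs_mult)
  qed
qed

text \<open>The full list is exempt: its sum is the total of the set, which no ordering can
  change.\<close>

definition proper_infixes_nonzero :: "int \<Rightarrow> int list \<Rightarrow> bool" where
  "proper_infixes_nonzero m xs \<longleftrightarrow>
     (\<forall>u v w. xs = u @ v @ w \<longrightarrow> v \<noteq> [] \<longrightarrow> u @ w \<noteq> [] \<longrightarrow> \<not> m dvd sum_list v)"

text \<open>After dilation by \<open>l\<close> every \<open>a \<in> A\<close> has an integer
  representative \<open>g a\<close> of size at most \<open>card B * M * p / Q\<close>. The bound on
  \<open>Q\<close> makes every sum of representatives of distinct elements smaller than
  \<open>p\<close>, so divisibility by \<open>p\<close> means vanishing in the integers, where
  \<open>integer_order\<close> applies.\<close>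

lemma rectifiable_order:
  fixes A B :: "int set" and p :: nat
  assumes p: "prime p" and A: "A \<subseteq> {1..<int p}" "A \<subseteq> box p B M"
    and B: "finite B" and M: "M \<ge> 0" and Q: "Q > int (card A) * int (card B) * M" "Q ^ card B < int p"
  shows "\<exists>xs. distinct xs \<and> set xs = A \<and> proper_infixes_nonzero p xs"
proof -
  have finA: "finite A" using A(1) finite_subset by blast
  have Q0: "Q > 0" using Q M by (smt (verit) of_nat_0_le_iff mult_nonneg_nonneg)
  have p0: "int p > 0" using p prime_gt_0_nat by simp
  obtain l r where l: "0 < l" "l < int p" "\<And>b. b \<in> B \<Longrightarrow> [l * b = r b] (mod int p)"
    "\<And>b. b \<in> B \<Longrightarrow> Q * \<bar>r b\<bar> \<le> int p"
    using dilate_to_small[OF B p0 Q0 Q(2)] by blast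
  have pl: "\<not> int p dvd l" using l(1,2) by (simp add: zdvd_not_zless)
  have pdvd: "int p dvd l * v \<longleftrightarrow> int p dvd v" for v
    using pl p by (simp add: prime_dvd_mult_iff)
  have "\<exists>z. [l * a = z] (mod int p) \<and> Q * \<bar>z\<bar> \<le> int (card B) * M * int p" if a: "a \<in> A" for a
  proof -
    obtain \<beta> where \<beta>: "\<forall>b\<in>B. \<bar>\<beta> b\<bar> \<le> M" "[a = (\<Sum>b\<in>B. \<beta> b * b)] (mod int p)"
      using A(2) a unfolding box_def by blast
    have "[l * a = l * (\<Sum>b\<in>B. \<beta> b * b)] (mod int p)" by (rule cong_scalar_left[OF \<beta>(2)])
    also have "l * (\<Sum>b\<in>B. \<beta> b * b) = (\<Sum>b\<in>B. \<beta> b * (l * b))" by (simp add: sum_distrib_left algebra_simps)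
    also have "[\<dots> = (\<Sum>b\<in>B. \<beta> b * r b)] (mod int p)" by (intro cong_sum cong_scalar_left l(3))
    finally have c: "[l * a = (\<Sum>b\<in>B. \<beta> b * r b)] (mod int p)" .
    have "Q * \<bar>\<Sum>b\<in>B. \<beta> b * r b\<bar> \<le> Q * (\<Sum>b\<in>B. \<bar>\<beta> b\<bar> * \<bar>r b\<bar>)"
      using Q0 sum_abs[of "\<lambda>b. \<beta> b * r b" B] by (simp add: abs_mult)
    also have "\<dots> = (\<Sum>b\<in>B. \<bar>\<beta> b\<bar> * (Q * \<bar>r b\<bar>))" by (simp add: sum_distrib_left algebra_simps)
    also have "\<dots> \<le> (\<Sum>b\<in>B. M * int p)"
      using \<beta>(1) l(4) Q0 M by (intro sum_mono mult_mono) auto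
    finally show ?thesis using c by (auto simp: mult.assoc)
  qed
  then obtain g where g: "\<And>a. a \<in> A \<Longrightarrow> [l * a = g a] (mod int p)"
    "\<And>a. a \<in> A \<Longrightarrow> Q * \<bar>g a\<bar> \<le> int (card B) * M * int p"
    by metis
  have dvd_eq: "a = b" if "a \<in> A" "b \<in> A" "int p dvd a - b" for a b
  proof -
    have "\<bar>a - b\<bar> < int p" using that A(1) by (auto simp: subset_iff) (smt (verit) that A(1) subsetD atLeastLessThan_iff)
    then show ?thesis using that(3) zdvd_imp_le[of "int p" "\<bar>a - b\<bar>"] by (cases "a = b") auto
  qed
  have inj: "inj_on g A"
  proof (rule inj_onI)
    fix a b assume ab: "a \<in> A" "b \<in> A" "g a = g b"
    have "[l * a = l * b] (mod int p)" using g(1)[OF ab(1)] g(1)[OF ab(2)] ab(3) by (metis cong_sym cong_trans)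
    then have "int p dvd l * (a - b)" by (simp add: cong_iff_dvd_diff right_diff_distrib)
    then show "a = b" using pdvd dvd_eq ab by blast
  qed
  have nz: "0 \<notin> g ` A"
  proof
    assume "0 \<in> g ` A"
    then obtain a where a: "a \<in> A" "g a = 0" by auto
    then have "int p dvd a" using g(1)[OF a(1)] pdvd by (simp add: cong_0_iff)
    then show False using A(1) a(1) zdvd_imp_le[of "int p" a] by fastforce
  qed
  obtain ys where ys: "distinct ys" "set ys = g ` A"
    and ysn: "\<forall>u v w. ys = u @ v @ w \<longrightarrow> v \<noteq> [] \<longrightarrow> u @ w \<noteq> [] \<longrightarrow> sum_list v \<noteq> 0"
    using integer_order[of "g ` A"] finA nz by blast
  define xs where "xs = map (inv_into A g) ys"
  have gx: "map g xs = ys" unfolding xs_def map_map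
    by (intro map_idI) (simp add: ys(2) f_inv_into_f)
  have setx: "set xs = A"
    unfolding xs_def using inj ys(2) by (simp add: inv_into_image_cancel)
  have dx: "distinct xs" using gx ys(1) distinct_map by blast
  have sums: "[l * sum_list v = sum_list (map g v)] (mod int p)" if "set v \<subseteq> A" for v
    using that by (induction v) (auto simp: distrib_left intro!: cong_add g(1))
  have small: "\<bar>sum_list (map g v)\<bar> < int p" if "set v \<subseteq> A" "distinct v" for v
  proof -
    have "length v \<le> card A" using that finA by (metis card_mono distinct_card)
    have "Q * \<bar>sum_list (map g v)\<bar> \<le> int (length v) * (int (card B) * M * int p)"
      using that(1)
    proof (induction v)
      case (Cons a v)
      have "Q * \<bar>g a + sum_list (map g v)\<bar> \<le> Q * \<bar>g a\<bar> + Q * \<bar>sum_list (map g v)\<bar>"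
        using Q0 abs_triangle_ineq[of "g a" "sum_list (map g v)"] by (simp flip: distrib_left)
      then show ?case using Cons g(2)[of a] by (simp add: algebra_simps)
    qed simp
    also have "\<dots> \<le> int (card A) * (int (card B) * M * int p)"
      using \<open>length v \<le> card A\<close> M by (intro mult_right_mono) auto
    also have "\<dots> < Q * int p" using Q(1) p0 by (simp add: mult.assoc[symmetric])
    finally show ?thesis using Q0 by simp
  qed
  have "proper_infixes_nonzero p xs"
    unfolding proper_infixes_nonzero_def
  proof (intro allI impI notI)
    fix u v w assume *: "xs = u @ v @ w" "v \<noteq> []" "u @ w \<noteq> []" "int p dvd sum_list v"
    have v: "set v \<subseteq> A" "distinct v" using *(1) setx dx by auto
    have "int p dvd sum_list (map g v)"
      using sums[OF v(1)] *(4) by (simp add: cong_dvd_iff[OF sums[OF v(1)], symmetric])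
    then have "sum_list (map g v) = 0"
      using small[OF v] zdvd_imp_le[of "int p" "\<bar>sum_list (map g v)\<bar>"] by fastforce
    moreover have "ys = map g u @ map g v @ map g w" using gx *(1) by (metis map_append)
    ultimately show False using ysn[rule_format, of "map g u" "map g v" "map g w"] *(2,3) by simp
  qed
  then show ?thesis using dx setx by blast
qed

section \<open>Dissociated sets\<close>

text \<open>Equivalent to the usual form, no nontrivial relation with coefficients -1, 0, 1, since
  such a combination is a difference of two subset sums. The subset form is the one that recovers
  the set of an infix from its sum.\<close>

definition dissociated :: "int \<Rightarrow> int set \<Rightarrow> bool" where
  "dissociated m D \<longleftrightarrow> finite D \<and> (\<forall>S T. S \<subseteq> D \<longrightarrow> T \<subseteq> D \<longrightarrow> [\<Sum>S = \<Sum>T] (mod m) \<longrightarrow> S = T)"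

lemma dissociatedD:
  "dissociated m D \<Longrightarrow> S \<subseteq> D \<Longrightarrow> T \<subseteq> D \<Longrightarrow> [\<Sum>S = \<Sum>T] (mod m) \<Longrightarrow> S = T"
  unfolding dissociated_def by blast

lemma dissociated_finite: "dissociated m D \<Longrightarrow> finite D"
  unfolding dissociated_def by blast

lemma dissociated_subset: "dissociated m D \<Longrightarrow> D' \<subseteq> D \<Longrightarrow> dissociated m D'"
  unfolding dissociated_def by (meson finite_subset order_trans)

lemma dissociated_sum_nonzero:
  assumes "dissociated m D" "S \<subseteq> D" "S \<noteq> {}"
  shows "\<not> m dvd \<Sum>S"
  using dissociatedD[OF assms(1,2), of "{}"] assms(3) by (auto simp: cong_0_iff)

lemma dissociated_cong_eq:
  assumes "dissociated m D" "x \<in> D" "y \<in> D" "[x = y] (mod m)"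
  shows "x = y"
  using dissociatedD[OF assms(1), of "{x}" "{y}"] assms(2-4) by auto

text \<open>In a coincidence of two subset sums of \<open>insert a B\<close>, \<open>a\<close> lies
  in exactly one of the sets: otherwise it cancels or is absent, against the dissociativity of
  \<open>B\<close>. Solving for \<open>a\<close> gives coefficients -1, 0, 1.\<close>

lemma not_dissociated_insert:
  assumes B: "dissociated m B" and a: "a \<notin> B" "\<not> dissociated m (insert a B)"
  shows "a \<in> box m B 1"
proof -
  have fin: "finite B" using B by (rule dissociated_finite)
  have key: "a \<in> box m B 1" if S: "S \<subseteq> insert a B" and T: "T \<subseteq> B" and c: "[\<Sum>S = \<Sum>T] (mod m)" and aS: "a \<in> S" for S T
  proof -
    define S' where "S' = S - {a}"
    have S': "S' \<subseteq> B" "finite S'" using S fin finite_subset[of S' B] by (auto simp: S'_def)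
    have "\<Sum>S = a + \<Sum>S'"
      using sum.remove[of S a "\<lambda>x. x"] aS finite_subset[OF S] fin by (simp add: S'_def)
    then have eq: "a - (\<Sum>T - \<Sum>S') = \<Sum>S - \<Sum>T" by simp
    have "[a = \<Sum>T - \<Sum>S'] (mod m)"
      using c unfolding cong_iff_dvd_diff eq .
    also have "\<Sum>T - \<Sum>S' = (\<Sum>b\<in>B. (if b \<in> T then b else 0) - (if b \<in> S' then b else 0))"
      using sum.inter_restrict[OF fin, of "\<lambda>b. b" T] sum.inter_restrict[OF fin, of "\<lambda>b. b" S'] T S'(1)
      by (simp add: sum_subtractf Int_absorb1)
    also have "\<dots> = (\<Sum>b\<in>B. ((if b \<in> T then 1 else 0) - (if b \<in> S' then 1 else 0)) * b)"
      by (intro sum.cong) auto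
    finally show ?thesis
      unfolding box_def by (intro CollectI exI[of _ "\<lambda>b. (if b \<in> T then 1 else 0) - (if b \<in> S' then 1 else 0)"] conjI ballI) simp_all
  qed
  obtain S T where ST: "S \<subseteq> insert a B" "T \<subseteq> insert a B" "[\<Sum>S = \<Sum>T] (mod m)" "S \<noteq> T"
    using a(2) fin unfolding dissociated_def by blast
  show ?thesis
  proof (cases "a \<in> S")
    case True
    show ?thesis
    proof (cases "a \<in> T")
      case aT: True
      have "\<Sum>S = a + \<Sum>(S - {a})" "\<Sum>T = a + \<Sum>(T - {a})"
        using sum.remove[of S a "\<lambda>x. x"] sum.remove[of T a "\<lambda>x. x"] True aT finite_subset[OF ST(1)] finite_subset[OF ST(2)] fin by simp_all
      then have "[\<Sum>(S - {a}) = \<Sum>(T - {a})] (mod m)" using ST(3) by (simp add: cong_add_lcancel)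
      moreover have "S - {a} \<subseteq> B" "T - {a} \<subseteq> B" using ST(1,2) by auto
      ultimately have eq: "S - {a} = T - {a}" by (intro dissociatedD[OF B])
      have "S = insert a (S - {a})" using True by (rule insert_Diff[symmetric])
      also have "\<dots> = insert a (T - {a})" by (simp only: eq)
      also have "\<dots> = T" using aT by (rule insert_Diff)
      finally have "S = T" .
      then show ?thesis using ST(4) by simp
    next
      case False
      then show ?thesis using key[of S T] ST True by blast
    qed
  next
    case False
    show ?thesis
    proof (cases "a \<in> T")
      case True
      then show ?thesis using key[of T S] ST False cong_sym by blast
    next
      case aT: False
      then show ?thesis using dissociatedD[OF B] ST False by blast
    qed
  qed
qed

text \<open>A largest dissociated subset \<open>B\<close> works: any further element breaks
  dissociativity and hence lies in the box. Excluding size exactly \<open>R\<close> bounds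
  \<open>card B\<close> because dissociativity passes to subsets.\<close>

lemma small_dimension_box:
  assumes "finite A" "\<And>D. D \<subseteq> A \<Longrightarrow> dissociated m D \<Longrightarrow> card D \<noteq> R"
  obtains B where "B \<subseteq> A" "card B < R" "A \<subseteq> box m B 1"
proof -
  have fin: "finite (card ` {B. B \<subseteq> A \<and> dissociated m B})" using assms(1) by simp
  have ne: "card ` {B. B \<subseteq> A \<and> dissociated m B} \<noteq> {}"
    by (auto simp: dissociated_def)
  obtain B where B: "B \<subseteq> A" "dissociated m B" and max: "\<And>B'. B' \<subseteq> A \<Longrightarrow> dissociated m B' \<Longrightarrow> card B' \<le> card B"
  proof -
    obtain B where B: "Max (card ` {B. B \<subseteq> A \<and> dissociated m B}) = card B" "B \<subseteq> A" "dissociated m B"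
      using Max_in[OF fin ne] by blast
    have "card B' \<le> card B" if "B' \<subseteq> A" "dissociated m B'" for B'
      using Max_ge[OF fin, of "card B'"] that B(1) by simp
    then show ?thesis using that B by blast
  qed
  have finB: "finite B" using B(2) dissociated_finite by blast
  have "card B < R"
  proof (rule ccontr)
    assume "\<not> card B < R"
    then obtain D where "D \<subseteq> B" "card D = R" using obtain_subset_with_card_n[of R B] by auto
    then show False using assms(2)[of D] B dissociated_subset by blast
  qed
  moreover have "A \<subseteq> box m B 1"
  proof
    fix a assume a: "a \<in> A"
    show "a \<in> box m B 1"
    proof (cases "a \<in> B")
      case True
      then show ?thesis using box_base finB by simp
    next
      case False
      then have "\<not> dissociated m (insert a B)" using max[of "insert a B"] a B(1) finB by auto
      then show ?thesis using not_dissociated_insert B(2) False by blast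
    qed
  qed
  ultimately show ?thesis using that B(1) by blast
qed

lemma dissociated_decomposition:
  fixes A :: "int set"
  assumes "finite A" "R > 0"
  shows "\<exists>(s::nat) D B. (\<forall>i<s. D i \<subseteq> A \<and> card (D i) = R \<and> dissociated m (D i)) \<and>
    (\<forall>i<s. \<forall>j<s. i \<noteq> j \<longrightarrow> D i \<inter> D j = {}) \<and>
    B \<subseteq> A - (\<Union>i<s. D i) \<and> card B < R \<and> A - (\<Union>i<s. D i) \<subseteq> box m B 1"
  using assms(1)
proof (induction "card A" arbitrary: A rule: less_induct)
  case less
  show ?case
  proof (cases "\<exists>D\<subseteq>A. dissociated m D \<and> card D = R")
    case False
    then obtain B where "B \<subseteq> A" "card B < R" "A \<subseteq> box m B 1"
      using small_dimension_box[OF less.prems, of m R] by metis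
    then show ?thesis by (intro exI[of _ 0] exI[of _ "\<lambda>_. {}"] exI[of _ B]) simp
  next
    case True
    then obtain D0 where D0: "D0 \<subseteq> A" "dissociated m D0" "card D0 = R" by blast
    then have "D0 \<noteq> {}" using assms(2) by auto
    then have "card (A - D0) < card A" using D0(1) less.prems by (intro psubset_card_mono) auto
    moreover have "finite (A - D0)" using less.prems by simp
    ultimately have "\<exists>(s::nat) D B. (\<forall>i<s. D i \<subseteq> A - D0 \<and> card (D i) = R \<and> dissociated m (D i)) \<and>
      (\<forall>i<s. \<forall>j<s. i \<noteq> j \<longrightarrow> D i \<inter> D j = {}) \<and>
      B \<subseteq> A - D0 - (\<Union>i<s. D i) \<and> card B < R \<and> A - D0 - (\<Union>i<s. D i) \<subseteq> box m B 1"
      by (rule less.hyps)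
    then obtain s :: nat and D B where
      IH: "\<forall>i<s. D i \<subseteq> A - D0 \<and> card (D i) = R \<and> dissociated m (D i)"
        "\<forall>i<s. \<forall>j<s. i \<noteq> j \<longrightarrow> D i \<inter> D j = {}"
        "B \<subseteq> A - D0 - (\<Union>i<s. D i)" "card B < R" "A - D0 - (\<Union>i<s. D i) \<subseteq> box m B 1"
      by (elim exE conjE) (rule that)
    define D' where "D' = (\<lambda>i. if i = s then D0 else D i)"
    have un: "(\<Union>i<Suc s. D' i) = D0 \<union> (\<Union>i<s. D i)"
      by (auto simp: D'_def lessThan_Suc)
    have "D' i \<subseteq> A \<and> card (D' i) = R \<and> dissociated m (D' i)" if "i < Suc s" for i
    proof (cases "i = s")
      case True
      then show ?thesis using D0 by (simp add: D'_def)
    next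
      case False
      then have "i < s" using that by simp
      then show ?thesis using IH(1) False by (auto simp: D'_def)
    qed
    moreover have "D' i \<inter> D' j = {}" if ij: "i < Suc s" "j < Suc s" "i \<noteq> j" for i j
    proof -
      consider "i < s" "j < s" | "i = s" "j < s" | "i < s" "j = s" using ij by (auto simp: less_Suc_eq)
      then show ?thesis
        using IH(1,2) ij(3) by cases (auto simp: D'_def)
    qed
    moreover have "A - (\<Union>i<Suc s. D' i) = A - D0 - (\<Union>i<s. D i)" unfolding un by blast
    ultimately show ?thesis
      using IH(3-5) by (intro exI[of _ "Suc s"] exI[of _ D'] exI[of _ B]) simp
  qed
qed

section \<open>Counting orderings: infix sums, greedy choices, conditioning\<close>

text \<open>By dissociativity the sum determines the set \<open>S\<close> of the infix, so such a
  permutation is an ordering of \<open>S\<close> together with an ordering of \<open>D - S\<close>.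
  The probability is thus at most the reciprocal of \<open>card D choose a\<close>.\<close>

lemma card_perms_with_infix_sum:
  assumes "dissociated m D" "i + a \<le> card D"
  shows "card {\<tau> \<in> permutations_of_set D. [sum_list (take a (drop i \<tau>)) = z] (mod m)} \<le> fact a * fact (card D - a)"
    (is "card ?X \<le> _")
proof (cases "?X = {}")
  case False
  then obtain \<tau>0 where \<tau>0: "\<tau>0 \<in> ?X" by blast
  have fin: "finite D" using assms(1) dissociated_finite by blast
  define S where "S = set (take a (drop i \<tau>0))"
  have seg: "set (take a (drop i \<tau>)) \<subseteq> D \<and> card (set (take a (drop i \<tau>))) = a \<and>
      sum_list (take a (drop i \<tau>)) = \<Sum>(set (take a (drop i \<tau>)))" if "\<tau> \<in> permutations_of_set D" for \<tau>
  proof -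
    have t: "distinct \<tau>" "set \<tau> = D" "length \<tau> = card D"
      using that by (simp_all add: permutations_of_setD length_finite_permutations_of_set)
    have "set (take a (drop i \<tau>)) \<subseteq> D" using t(2) by (metis set_drop_subset set_take_subset order_trans)
    moreover have "card (set (take a (drop i \<tau>))) = a" using t assms(2) by (simp add: distinct_card)
    moreover have "sum_list (take a (drop i \<tau>)) = \<Sum>(set (take a (drop i \<tau>)))"
      using t by (intro distinct_sum_list_conv_Sum) simp
    ultimately show ?thesis by simp
  qed
  have S: "S \<subseteq> D" "card S = a" using seg[of \<tau>0] \<tau>0 by (auto simp: S_def)
  have same: "set (take a (drop i \<tau>)) = S" if "\<tau> \<in> ?X" for \<tau>
    unfolding S_def
  proof (rule dissociatedD[OF assms(1)])
    show "[\<Sum>(set (take a (drop i \<tau>))) = \<Sum>(set (take a (drop i \<tau>0)))] (mod m)"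
    proof -
      have "[sum_list (take a (drop i \<tau>)) = z] (mod m)" "[sum_list (take a (drop i \<tau>0)) = z] (mod m)"
        using that \<tau>0 by simp_all
      then have "[sum_list (take a (drop i \<tau>)) = sum_list (take a (drop i \<tau>0))] (mod m)"
        using cong_sym cong_trans by blast
      then show ?thesis using seg[of \<tau>] seg[of \<tau>0] that \<tau>0 by simp
    qed
  qed (use seg that \<tau>0 in blast)+
  define f where "f = (\<lambda>\<tau>::int list. (take a (drop i \<tau>), take i \<tau> @ drop (i + a) \<tau>))"
  have split: "\<tau> = take i \<tau> @ take a (drop i \<tau>) @ drop (i + a) \<tau>" for \<tau> :: "int list"
    by (metis append_take_drop_id drop_drop add.commute)
  have "inj_on f ?X"
  proof (rule inj_onI)
    fix \<tau> \<tau>' assume h: "\<tau> \<in> ?X" "\<tau>' \<in> ?X" "f \<tau> = f \<tau>'"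
    then have "length \<tau> = card D" "length \<tau>' = card D"
      by (simp_all add: length_finite_permutations_of_set)
    then have "take i \<tau> = take i \<tau>'" "drop (i + a) \<tau> = drop (i + a) \<tau>'" "take a (drop i \<tau>) = take a (drop i \<tau>')"
      using h(3) assms(2) by (auto simp: f_def append_eq_append_conv)
    then show "\<tau> = \<tau>'" using split[of \<tau>] split[of \<tau>'] by simp
  qed
  moreover have "f ` ?X \<subseteq> permutations_of_set S \<times> permutations_of_set (D - S)"
  proof
    fix y assume "y \<in> f ` ?X"
    then obtain \<tau> where \<tau>: "\<tau> \<in> ?X" "y = f \<tau>" by blast
    have t: "distinct (take i \<tau> @ take a (drop i \<tau>) @ drop (i + a) \<tau>)" "set (take i \<tau> @ take a (drop i \<tau>) @ drop (i + a) \<tau>) = D"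
      using \<tau>(1) split[of \<tau>] by (auto simp: permutations_of_set_def)
    then show "y \<in> permutations_of_set S \<times> permutations_of_set (D - S)"
      using same[OF \<tau>(1)] \<tau>(2) by (auto simp: f_def permutations_of_set_def)
  qed
  ultimately have "card ?X \<le> card (permutations_of_set S \<times> permutations_of_set (D - S))"
    by (intro card_inj_on_le[of f]) auto
  also have "\<dots> = fact a * fact (card D - a)"
    using S fin finite_subset[OF S(1) fin] by (simp add: card_cartesian_product card_permutations_of_set card_Diff_subset)
  finally show ?thesis .
next
  case True
  then show ?thesis by (simp only: card.empty)
qed

text \<open>Positions are filled from the left: each of the first \<open>M\<close> leaves at least
  \<open>q\<close> choices, whatever came before, and the rest is arbitrary.\<close>

lemma card_perms_greedy:
  fixes D :: "'a set"
  assumes "finite D" "M \<le> card D"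
    "\<And>p. distinct p \<Longrightarrow> set p \<subseteq> D \<Longrightarrow> length p < M \<Longrightarrow> (\<forall>k<length p. P (take k p) (p ! k)) \<Longrightarrow>
      q \<le> card {y \<in> D - set p. P p y}"
  shows "q ^ M * fact (card D - M) \<le> card {\<rho> \<in> permutations_of_set D. \<forall>k<M. P (take k \<rho>) (\<rho> ! k)}"
  using assms
proof (induction M arbitrary: D P)
  case 0
  then show ?case by simp
next
  case (Suc M)
  define Y where "Y = {y \<in> D. P [] y}"
  have finY: "finite Y" using Suc.prems(1) by (simp add: Y_def)
  define G where "G = (\<lambda>x. {\<rho> \<in> permutations_of_set (D - {x}). \<forall>k<M. P (x # take k \<rho>) (\<rho> ! k)})"
  have qY: "q \<le> card Y" using Suc.prems(3)[of "[]"] by (simp add: Y_def)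
  have G: "q ^ M * fact (card D - Suc M) \<le> card (G x)" if x: "x \<in> Y" for x
  proof -
    have xD: "x \<in> D" "P [] x" using x by (auto simp: Y_def)
    have "q ^ M * fact (card (D - {x}) - M) \<le> card {\<rho> \<in> permutations_of_set (D - {x}). \<forall>k<M. (\<lambda>p. P (x # p)) (take k \<rho>) (\<rho> ! k)}"
    proof (rule Suc.IH)
      fix p assume p: "distinct p" "set p \<subseteq> D - {x}" "length p < M" "\<forall>k<length p. P (x # take k p) (p ! k)"
      have "\<forall>k<length (x # p). P (take k (x # p)) ((x # p) ! k)"
        using p(4) xD by (auto simp: less_Suc_eq_0_disj)
      then have "q \<le> card {y \<in> D - set (x # p). P (x # p) y}"
        using p xD by (intro Suc.prems(3)) auto
      also have "D - set (x # p) = D - {x} - set p" by auto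
      finally show "q \<le> card {y \<in> D - {x} - set p. P (x # p) y}" .
    qed (use Suc.prems xD in auto)
    then show ?thesis using xD Suc.prems(1) by (simp add: G_def)
  qed
  have "q ^ Suc M * fact (card D - Suc M) = q * (q ^ M * fact (card D - Suc M))" by simp
  also have "\<dots> \<le> card Y * (q ^ M * fact (card D - Suc M))" using qY by (rule mult_right_mono) simp
  also have "\<dots> = (\<Sum>x\<in>Y. q ^ M * fact (card D - Suc M))" by simp
  also have "\<dots> \<le> (\<Sum>x\<in>Y. card (Cons x ` G x))"
    using G by (intro sum_mono) (simp add: card_image)
  also have "\<dots> = card (\<Union>x\<in>Y. Cons x ` G x)"
    using finY Suc.prems(1) by (intro card_UN_disjoint[symmetric]) (auto simp: G_def)
  also have "\<dots> \<le> card {\<rho> \<in> permutations_of_set D. \<forall>k<Suc M. P (take k \<rho>) (\<rho> ! k)}"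
  proof (rule card_mono)
    show "(\<Union>x\<in>Y. Cons x ` G x) \<subseteq> {\<rho> \<in> permutations_of_set D. \<forall>k<Suc M. P (take k \<rho>) (\<rho> ! k)}"
      by (auto simp: G_def Y_def permutations_of_set_def less_Suc_eq_0_disj)
  qed (use Suc.prems(1) in simp)
  finally show ?case .
qed

text \<open>A union bound on a restricted space \<open>\<Omega>\<close> that is not a product. At
  least a share \<open>\<theta>\<close> of the values of one coordinate stays in
  \<open>\<Omega>\<close>, so resampling the coordinate attached to an event bounds its frequency in
  \<open>\<Omega>\<close> by \<open>\<eta> / \<theta>\<close>.\<close>

lemma card_perms_avoid:
  fixes X :: "'i \<Rightarrow> 'x set" and \<Omega> :: "('i \<Rightarrow> 'x) set"
  assumes \<Omega>: "\<Omega> \<subseteq> PiE I X" "\<Omega> \<noteq> {}" "finite I" "\<And>i. i \<in> I \<Longrightarrow> finite (X i)"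
    and \<theta>: "\<And>\<rho> i. \<rho> \<in> \<Omega> \<Longrightarrow> i \<in> I \<Longrightarrow> \<theta> * real (card (X i)) \<le> real (card {\<sigma> \<in> X i. \<rho>(i := \<sigma>) \<in> \<Omega>})"
    and ev: "finite Ev" "\<And>e. e \<in> Ev \<Longrightarrow> (\<forall>\<rho>\<in>\<Omega>. \<not> P e \<rho>) \<or>
      (\<exists>i\<in>I. \<forall>\<rho>\<in>\<Omega>. real (card {\<sigma> \<in> X i. P e (\<rho>(i := \<sigma>))}) \<le> \<eta> * real (card (X i)))"
    and small: "real (card Ev) * \<eta> < \<theta>" "0 < \<theta>" "0 \<le> \<eta>"
  shows "\<exists>\<rho>\<in>\<Omega>. \<forall>e\<in>Ev. \<not> P e \<rho>"
proof (rule ccontr)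
  assume neg: "\<not> ?thesis"
  have fin\<Omega>: "finite \<Omega>" using \<Omega> by (meson finite_PiE finite_subset)
  have bound: "\<theta> * real (card {\<rho> \<in> \<Omega>. P e \<rho>}) \<le> \<eta> * real (card \<Omega>)" if e: "e \<in> Ev" for e
  proof -
    define N where "N = {\<rho> \<in> \<Omega>. P e \<rho>}"
    consider "N = {}" | i where "i \<in> I" "\<forall>\<rho>\<in>\<Omega>. real (card {\<sigma> \<in> X i. P e (\<rho>(i := \<sigma>))}) \<le> \<eta> * real (card (X i))"
      using ev(2)[OF e] unfolding N_def by blast
    then show ?thesis
    proof cases
      case 1
      then have "card {\<rho> \<in> \<Omega>. P e \<rho>} = 0" unfolding N_def by (metis card.empty)
      then show ?thesis using small by simp
    next
      case (2 i)
      have Xi: "finite (X i)" using \<Omega>(4) 2(1) by blast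
      have mem: "\<rho> i \<in> X i" if "\<rho> \<in> \<Omega>" for \<rho> using that \<Omega>(1) 2(1) by blast
      have pos: "card (X i) > 0" using mem \<Omega>(2) Xi by (auto simp: card_gt_0_iff)
      define T1 where "T1 = Sigma N (\<lambda>\<rho>. {\<sigma> \<in> X i. \<rho>(i := \<sigma>) \<in> \<Omega>})"
      define T2 where "T2 = Sigma \<Omega> (\<lambda>\<rho>. {\<sigma> \<in> X i. P e (\<rho>(i := \<sigma>))})"
      \<comment> \<open>Swapping the old and the new value of coordinate \<open>i\<close> is an
        involution. It sends pairs with the event before resampling to pairs with the event after
        resampling, and those are few by hypothesis.\<close>
      define f :: "('i \<Rightarrow> 'x) \<times> 'x \<Rightarrow> ('i \<Rightarrow> 'x) \<times> 'x" where "f = (\<lambda>(\<rho>, \<sigma>). (\<rho>(i := \<sigma>), \<rho> i))"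
      have "inj_on f T1"
      proof (rule inj_on_inverseI)
        fix y assume "y \<in> T1"
        show "f (f y) = y" by (cases y) (simp add: f_def)
      qed
      moreover have "f ` T1 \<subseteq> T2" using mem by (auto simp: f_def T1_def T2_def N_def)
      moreover have finT: "finite T2" using fin\<Omega> Xi by (simp add: T2_def)
      ultimately have "card T1 \<le> card T2" by (metis card_inj_on_le)
      have "\<theta> * real (card N) * real (card (X i)) = (\<Sum>\<rho>\<in>N. \<theta> * real (card (X i)))" by simp
      also have "\<dots> \<le> (\<Sum>\<rho>\<in>N. real (card {\<sigma> \<in> X i. \<rho>(i := \<sigma>) \<in> \<Omega>}))"
        using \<theta> 2(1) by (intro sum_mono) (auto simp: N_def)
      also have "\<dots> = real (card T1)"
        unfolding T1_def using fin\<Omega> Xi by (subst card_SigmaI) (auto simp: N_def)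
      also have "\<dots> \<le> real (card T2)" using \<open>card T1 \<le> card T2\<close> by simp
      also have "\<dots> = (\<Sum>\<rho>\<in>\<Omega>. real (card {\<sigma> \<in> X i. P e (\<rho>(i := \<sigma>))}))"
        unfolding T2_def using fin\<Omega> Xi by (subst card_SigmaI) auto
      also have "\<dots> \<le> (\<Sum>\<rho>\<in>\<Omega>. \<eta> * real (card (X i)))" using 2(2) by (intro sum_mono) blast
      also have "\<dots> = \<eta> * real (card \<Omega>) * real (card (X i))" by simp
      finally show ?thesis using pos by (simp add: N_def)
    qed
  qed
  have "\<Omega> \<subseteq> (\<Union>e\<in>Ev. {\<rho> \<in> \<Omega>. P e \<rho>})" using neg by auto
  then have "card \<Omega> \<le> card (\<Union>e\<in>Ev. {\<rho> \<in> \<Omega>. P e \<rho>})" using fin\<Omega> ev(1) by (intro card_mono) auto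
  also have "\<dots> \<le> (\<Sum>e\<in>Ev. card {\<rho> \<in> \<Omega>. P e \<rho>})" by (rule card_UN_le[OF ev(1)])
  finally have "\<theta> * real (card \<Omega>) \<le> (\<Sum>e\<in>Ev. \<theta> * real (card {\<rho> \<in> \<Omega>. P e \<rho>}))"
    using small(2) by (simp flip: sum_distrib_left of_nat_sum)
  also have "\<dots> \<le> (\<Sum>e\<in>Ev. \<eta> * real (card \<Omega>))" using bound by (intro sum_mono)
  also have "\<dots> = real (card Ev) * \<eta> * real (card \<Omega>)" by simp
  finally have "\<theta> * real (card \<Omega>) \<le> (real (card Ev) * \<eta>) * real (card \<Omega>)" .
  moreover have "card \<Omega> > 0" using \<Omega>(2) fin\<Omega> by (simp add: card_gt_0_iff)
  ultimately show False using small(1) by simp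
qed

text \<open>Index 0 is the part of a block used in the first round, any other index the rest. The
  length \<open>2 * K\<close> gives the short layer room for two disjoint ends of \<open>K\<close>
  elements.\<close>

definition layer :: "nat \<Rightarrow> nat \<Rightarrow> 'a list \<Rightarrow> 'a list" where
  "layer K h \<tau> = (if h = 0 then take (2 * K) \<tau> else drop (2 * K) \<tau>)"

text \<open>The four ends, each read from the boundary of its layer inwards: 0 and 1 are the start
  and the end of the first layer, 2 and 3 those of the second.\<close>

definition block_end :: "nat \<Rightarrow> nat \<Rightarrow> 'a list \<Rightarrow> 'a list" where
  "block_end K g \<tau> = (if even g then layer K (g div 2) \<tau> else rev (layer K (g div 2) \<tau>))"

text \<open>The ends are chosen greedily, one after the other. Of the \<open>q + 4 * K\<close>
  admissible values at each step fewer than \<open>4 * K\<close> are already in use, so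
  \<open>q\<close> remain. The pools \<open>C g\<close> allow an end to be confined to a part of
  \<open>D\<close>.\<close>

lemma card_perms_good_ends:
  fixes D :: "int set"
  assumes "finite D" "4 * K \<le> card D" "K > 0"
    and C: "\<And>g. g < 4 \<Longrightarrow> C g \<subseteq> D"
    and good: "\<And>g S. g < 4 \<Longrightarrow> S \<subseteq> C g \<Longrightarrow> card S < K \<Longrightarrow> q + 4 * K \<le> card {y \<in> C g. \<not> Bad g (\<Sum>S + y)}"
  shows "q ^ (4 * K) * fact (card D - 4 * K) \<le>
    card {\<tau> \<in> permutations_of_set D. \<forall>g<4. \<forall>k\<in>{1..K}. \<not> Bad g (sum_list (take k (block_end K g \<tau>)))}"
proof -
  \<comment> \<open>\<open>g\<close> is the end being filled, and \<open>drop (g * K) p\<close> is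
    what has been chosen for it so far.\<close>
  define P where "P = (\<lambda>p y. let g = length p div K in y \<in> C g \<and> \<not> Bad g (sum_list (drop (g * K) p) + y))"
  \<comment> \<open>Moves the four segments of length \<open>K\<close> that are chosen first to the
    four ends; those at the right of a layer are reversed because their sums grow from the
    right.\<close>
  define \<phi> :: "int list \<Rightarrow> int list" where "\<phi> = (\<lambda>\<rho>. take K \<rho> @ rev (take K (drop K \<rho>)) @ take K (drop (2 * K) \<rho>) @
    drop (4 * K) \<rho> @ rev (take K (drop (3 * K) \<rho>)))"
  let ?G = "{\<rho> \<in> permutations_of_set D. \<forall>k<4 * K. P (take k \<rho>) (\<rho> ! k)}"
  let ?H = "{\<tau> \<in> permutations_of_set D. \<forall>g<4. \<forall>k\<in>{1..K}. \<not> Bad g (sum_list (take k (block_end K g \<tau>)))}"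
  have "q ^ (4 * K) * fact (card D - 4 * K) \<le> card ?G"
  proof (rule card_perms_greedy[OF assms(1,2)])
    fix p assume p: "distinct p" "set p \<subseteq> D" "length p < 4 * K" "\<forall>k<length p. P (take k p) (p ! k)"
    define g where "g = length p div K"
    define S where "S = set (drop (g * K) p)"
    have g4: "g < 4" using p(3) by (simp add: g_def less_mult_imp_div_less)
    have "S \<subseteq> C g"
    proof
      fix x assume "x \<in> S"
      then obtain j where j: "j < length p - g * K" "x = p ! (g * K + j)"
        by (auto simp: S_def in_set_conv_nth)
      define k where "k = g * K + j"
      have k: "k < length p" using j(1) by (simp add: k_def)
      have "k div K = g"
      proof (rule antisym)
        show "k div K \<le> g" unfolding g_def using k by (intro div_le_mono) simp
        show "g \<le> k div K" using assms(3) by (simp add: less_eq_div_iff_mult_less_eq k_def)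
      qed
      moreover have "P (take k p) (p ! k)" using p(4) k by blast
      ultimately show "x \<in> C g" using k j(2) by (simp add: P_def Let_def k_def)
    qed
    moreover have "length p - g * K < K"
      using assms(3) by (simp add: g_def minus_div_mult_eq_mod)
    then have "card S < K"
      using card_length[of "drop (g * K) p"] by (simp add: S_def)
    ultimately have "q + 4 * K \<le> card {y \<in> C g. \<not> Bad g (\<Sum>S + y)}" by (intro good g4)
    moreover have "\<Sum>S = sum_list (drop (g * K) p)"
      using p(1) by (simp add: S_def distinct_sum_list_conv_Sum)
    ultimately have "q + 4 * K \<le> card {y \<in> C g. P p y}" by (simp add: P_def Let_def g_def[symmetric])
    moreover have "card {y \<in> C g. P p y} \<le> card ({y \<in> D - set p. P p y} \<union> set p)"
      using assms(1) C[OF g4] by (intro card_mono) auto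
    moreover have "card ({y \<in> D - set p. P p y} \<union> set p) \<le> card {y \<in> D - set p. P p y} + card (set p)"
      by (rule card_Un_le)
    moreover have "card (set p) \<le> 4 * K" using card_length[of p] p(3) by linarith
    ultimately show "q \<le> card {y \<in> D - set p. P p y}" by linarith
  qed
  also have "card ?G \<le> card ?H"
  proof (rule card_inj_on_le)
    have split: "\<rho> = take K \<rho> @ take K (drop K \<rho>) @ take K (drop (2 * K) \<rho>) @ take K (drop (3 * K) \<rho>) @ drop (4 * K) \<rho>"
      for \<rho> :: "int list"
    proof -
      have "drop (j * K) \<rho> = take K (drop (j * K) \<rho>) @ drop (Suc j * K) \<rho>" for j
        by (metis append_take_drop_id drop_drop mult_Suc)
      from this[of 0] this[of 1] this[of 2] this[of 3] show ?thesis by (simp add: eval_nat_numeral)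
    qed
    show "inj_on \<phi> ?G"
    proof (rule inj_onI)
      fix \<rho> \<rho>' assume h: "\<rho> \<in> ?G" "\<rho>' \<in> ?G" "\<phi> \<rho> = \<phi> \<rho>'"
      have l: "length \<rho> = card D" "length \<rho>' = card D"
        using h(1,2) by (simp_all add: length_finite_permutations_of_set)
      have "take K \<rho> = take K \<rho>' \<and> take K (drop K \<rho>) = take K (drop K \<rho>') \<and> take K (drop (2 * K) \<rho>) = take K (drop (2 * K) \<rho>') \<and>
        drop (4 * K) \<rho> = drop (4 * K) \<rho>' \<and> take K (drop (3 * K) \<rho>) = take K (drop (3 * K) \<rho>')"
        using h(3) l assms(2) by (simp add: \<phi>_def)
      then show "\<rho> = \<rho>'" using split[of \<rho>] split[of \<rho>'] by simp
    qed
    show "\<phi> ` ?G \<subseteq> ?H"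
    proof
      fix \<tau> assume "\<tau> \<in> \<phi> ` ?G"
      then obtain \<rho> where \<rho>: "\<rho> \<in> permutations_of_set D" "\<forall>k<4 * K. P (take k \<rho>) (\<rho> ! k)" "\<tau> = \<phi> \<rho>" by blast
      have l: "length \<rho> = card D" using \<rho>(1) by (simp add: length_finite_permutations_of_set)
      have "mset \<tau> = mset (take K \<rho> @ take K (drop K \<rho>) @ take K (drop (2 * K) \<rho>) @ take K (drop (3 * K) \<rho>) @ drop (4 * K) \<rho>)"
        unfolding \<rho>(3) \<phi>_def by simp
      then have "mset \<tau> = mset \<rho>" using split[of \<rho>] by simp
      then have "\<tau> \<in> permutations_of_set D"
        using \<rho>(1) by (metis mset_eq_setD mset_eq_imp_distinct_iff permutations_of_setD permutations_of_setI)
      moreover have "\<not> Bad g (sum_list (take k (block_end K g \<tau>)))" if g: "g < 4" and k: "k \<in> {1..K}" for g k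
      proof -
        define a b c d r where "a = take K \<rho>" and "b = take K (drop K \<rho>)" and "c = take K (drop (2 * K) \<rho>)"
          and "d = take K (drop (3 * K) \<rho>)" and "r = drop (4 * K) \<rho>"
        have \<rho>': "\<rho> = a @ b @ c @ d @ r" unfolding a_def b_def c_def d_def r_def by (rule split)
        have len: "length a = K" "length b = K" "length c = K" "length d = K"
          using l assms(2) by (simp_all add: a_def b_def c_def d_def)
        have \<tau>': "\<tau> = a @ rev b @ c @ r @ rev d"
          unfolding \<rho>(3) \<phi>_def a_def b_def c_def d_def r_def ..
        have l0: "layer K 0 \<tau> = a @ rev b" and l1: "layer K 1 \<tau> = c @ r @ rev d"
          unfolding \<tau>' layer_def using len by simp_all
        have d: "drop (0 * K) \<rho> = a @ b @ c @ d @ r" "drop (1 * K) \<rho> = b @ c @ d @ r"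
          "drop (2 * K) \<rho> = c @ d @ r" "drop (3 * K) \<rho> = d @ r"
          unfolding \<rho>' using len by simp_all
        have "g = 0 \<or> g = 1 \<or> g = 2 \<or> g = 3" using g by linarith
        then have e: "take k (block_end K g \<tau>) = take k (drop (g * K) \<rho>)"
        proof (elim disjE)
          assume "g = 0"
          then show ?thesis using k len d(1) l0 by (simp add: block_end_def)
        next
          assume "g = 1"
          then show ?thesis using k len d(2) l0 by (simp add: block_end_def)
        next
          assume "g = 2"
          then show ?thesis using k len d(3) l1 by (simp add: block_end_def)
        next
          assume "g = 3"
          then show ?thesis using k len d(4) l1 by (simp add: block_end_def)
        qed
        define j where "j = g * K + (k - 1)"
        have "g * K + K \<le> 4 * K" using g by (metis Suc_leI add.commute mult_Suc mult_le_mono1)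
        then have j: "j < 4 * K" using k unfolding j_def by (simp, linarith)
        have jd: "j div K = g" using k by (intro div_nat_eqI) (auto simp: j_def algebra_simps)
        have "P (take j \<rho>) (\<rho> ! j)" using \<rho>(2) j by blast
        then have "\<not> Bad g (sum_list (drop (g * K) (take j \<rho>)) + \<rho> ! j)"
          using j l assms(2) by (simp add: P_def Let_def jd)
        moreover have "drop (g * K) (take j \<rho>) @ [\<rho> ! j] = take k (drop (g * K) \<rho>)"
        proof -
          have "take (Suc (k - 1)) (drop (g * K) \<rho>) = take (k - 1) (drop (g * K) \<rho>) @ [drop (g * K) \<rho> ! (k - 1)]"
            using j l assms(2) by (intro take_Suc_conv_app_nth) (simp add: j_def)
          then show ?thesis using k j l assms(2) by (simp add: j_def drop_take)
        qed
        then have "sum_list (take k (drop (g * K) \<rho>)) = sum_list (drop (g * K) (take j \<rho>)) + \<rho> ! j"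
          by (metis sum_list_append sum_list_simps(2) sum_list.Nil add_0_right)
        ultimately show ?thesis by (simp add: e)
      qed
      ultimately show "\<tau> \<in> ?H" by blast
    qed
  qed simp
  finally show ?thesis .
qed

text \<open>Either no translate of the box captures half of \<open>D\<close>, or \<open>D\<close> has a cluster near some \<open>c\<close>
  and sums of \<open>k\<close> cluster elements stay near \<open>k c\<close>; in the second case some \<open>b \<in> X\<close> keeps all of them
  away from the box, for otherwise \<open>X\<close> would lie in a box with two more generators.\<close>

lemma shielded_cluster:
  fixes B D X :: "int set" and N K \<tau> :: int
  assumes fin: "finite B" "finite D" and N: "N \<ge> 0" and K: "K \<ge> 0"
    and X: "\<And>c. \<not> X \<subseteq> box m (insert \<tau> (insert c B)) ((K + 1) * (N + 1))"
  obtains b C where "b \<in> X" "C \<subseteq> D" "card D \<le> 2 * card C" "\<tau> + b \<notin> box m B N"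
    "\<And>S. S \<subseteq> C \<Longrightarrow> int (card S) < K \<Longrightarrow> 2 * card {y \<in> C. \<tau> + b + \<Sum>S + y \<in> box m B N} \<le> card C"
proof (cases "\<exists>c. card D \<le> 2 * card {y \<in> D. y - c \<in> box m B N}")
  case False
  have sub: "box m B N \<subseteq> box m (insert \<tau> (insert 0 B)) N" using fin N by (intro box_mono) auto
  obtain b where b: "b \<in> X" "b \<notin> box m (insert \<tau> (insert 0 B)) ((K + 1) * (N + 1))" using X by blast
  have "\<tau> + b \<notin> box m B N"
  proof
    assume "\<tau> + b \<in> box m B N"
    then have "\<tau> + b \<in> box m (insert \<tau> (insert 0 B)) N" using sub by blast
    moreover have "\<tau> \<in> box m (insert \<tau> (insert 0 B)) 1" using fin by (intro box_base) simp_all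
    ultimately have "\<tau> + b - \<tau> \<in> box m (insert \<tau> (insert 0 B)) (N + 1)" by (rule box_diff)
    moreover have "N + 1 \<le> (K + 1) * (N + 1)" using N K by (simp add: algebra_simps)
    ultimately show False using b(2) box_mono[of "insert \<tau> (insert 0 B)" "insert \<tau> (insert 0 B)" "N + 1" "(K + 1) * (N + 1)" m] fin N K
      by auto
  qed
  \<comment> \<open>Without a cluster every translate of the box holds less than half of
    \<open>D\<close>, so any \<open>S\<close> will do.\<close>
  moreover have "2 * card {y \<in> D. \<tau> + b + \<Sum>S + y \<in> box m B N} \<le> card D" for S
  proof -
    have "\<not> card D \<le> 2 * card {y \<in> D. y - (- (\<tau> + b + \<Sum>S)) \<in> box m B N}" using False by blast
    then show ?thesis by (simp add: algebra_simps)
  qed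
  ultimately show ?thesis using that[of b D] b(1) by simp
next
  case True
  then obtain c where c: "card D \<le> 2 * card {y \<in> D. y - c \<in> box m B N}" by blast
  define C where "C = {y \<in> D. y - c \<in> box m B N}"
  define B' where "B' = insert \<tau> (insert c B)"
  have fB': "finite B'" using fin by (simp add: B'_def)
  have up: "v \<in> box m B' M" if "v \<in> box m B M" "M \<ge> 0" for v M
    using that fB' box_mono[of B' B M M m] by (auto simp: B'_def)
  obtain b where b: "b \<in> X" "b \<notin> box m B' ((K + 1) * (N + 1))" using X unfolding B'_def by blast
  \<comment> \<open>If the sum lay in the box, solving for \<open>b\<close> would express it with
    the further generators \<open>\<tau>\<close> and \<open>c\<close> and coefficients at most
    \<open>N + k * N + 1 + k = (k + 1) * (N + 1)\<close>; this is the origin of the bound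
    \<open>(K + 1) * (N + 1)\<close>.\<close>
  have far: "\<tau> + b + v \<notin> box m B N" if v: "v - k * c \<in> box m B (k * N)" and k: "0 \<le> k" "k \<le> K" for v k
  proof
    assume a: "\<tau> + b + v \<in> box m B N"
    have "\<tau> + b + v - (v - k * c) - \<tau> - k * c \<in> box m B' (N + k * N + 1 + k * 1)"
    proof (intro box_diff)
      show "\<tau> + b + v \<in> box m B' N" using up[OF a] N by simp
      show "v - k * c \<in> box m B' (k * N)" using up[OF v] N k by simp
      show "\<tau> \<in> box m B' 1" using fB' by (intro box_base) (auto simp: B'_def)
      show "k * c \<in> box m B' (k * 1)" using fB' k by (intro box_scale box_base) (auto simp: B'_def)
    qed
    then have "b \<in> box m B' (N + k * N + 1 + k * 1)" by simp
    moreover have "N + k * N + 1 + k * 1 = (k + 1) * (N + 1)" by (simp add: algebra_simps)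
    moreover have "(k + 1) * (N + 1) \<le> (K + 1) * (N + 1)" using k N by (intro mult_right_mono) auto
    ultimately show False using b(2) box_mono[of B' B' "(k + 1) * (N + 1)" "(K + 1) * (N + 1)" m] fB' N K by auto
  qed
  have none: "{y \<in> C. \<tau> + b + \<Sum>S + y \<in> box m B N} = {}" if S: "S \<subseteq> C" "int (card S) < K" for S
  proof -
    have "\<tau> + b + (\<Sum>S + y) \<notin> box m B N" if y: "y \<in> C" for y
    proof (rule far)
      have finS: "finite S" using S(1) fin(2) by (auto simp: C_def intro: finite_subset)
      have "(\<Sum>x\<in>S. x - c) + (y - c) \<in> box m B (int (card S) * N + N)"
        using S(1) y by (intro box_add box_sum finS) (auto simp: C_def)
      then show "\<Sum>S + y - (int (card S) + 1) * c \<in> box m B ((int (card S) + 1) * N)"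
        by (simp add: sum_subtractf algebra_simps)
    qed (use S in auto)
    then show ?thesis by (simp add: add.assoc)
  qed
  have "\<tau> + b \<notin> box m B N" using far[of 0 0] K by (simp add: box_zero)
  moreover have "2 * card {y \<in> C. \<tau> + b + \<Sum>S + y \<in> box m B N} \<le> card C" if "S \<subseteq> C" "int (card S) < K" for S
    unfolding none[OF that] by simp
  moreover have "C \<subseteq> D" "card D \<le> 2 * card C" using c by (auto simp: C_def)
  ultimately show ?thesis using that b(1) by blast
qed

section \<open>The two-layer word\<close>

lemma sum_list_take_concat:
  fixes f :: "nat \<Rightarrow> int list"
  shows "sum_list (take i (concat (map f [0..<n]))) = (\<Sum>d<n. sum_list (take (i - (\<Sum>e<d. length (f e))) (f d)))"
proof (induction n)
  case (Suc n)
  have "length (concat (map f [0..<n])) = (\<Sum>e<n. length (f e))"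
    by (induction n) simp_all
  then show ?case using Suc by simp
qed simp

lemma sum_list_take_rev:
  fixes xs :: "int list"
  assumes "r \<le> length xs"
  shows "sum_list (take r (rev xs)) = sum_list xs - sum_list (take (length xs - r) xs)"
proof -
  have "take r (rev xs) = rev (drop (length xs - r) xs)" using assms by (simp add: take_rev)
  moreover have "sum_list xs = sum_list (take (length xs - r) xs) + sum_list (drop (length xs - r) xs)"
    by (metis append_take_drop_id sum_list_append)
  ultimately show ?thesis by (simp add: sum_list_rev)
qed

lemma sum_list_drop_eq:
  fixes xs :: "int list"
  shows "sum_list (drop k xs) = sum_list xs - sum_list (take k xs)"
  by (metis add_diff_cancel_left' append_take_drop_id sum_list_append)

lemma sum_list_take_diff:
  fixes xs :: "int list"
  assumes "k \<le> n"
  shows "sum_list (take n xs) - sum_list (take k xs) = sum_list (take (n - k) (drop k xs))"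
  using take_add[of k "n - k" xs] assms by simp

text \<open>\<open>Z\<close> lists the values forbidden for nonempty prefix sums of the word.
  \<open>C0\<close> and \<open>C1\<close> are pools for its first and last elements that keep off
  \<open>Z\<close> the short prefixes and the prefixes missing only a few elements. At least
  \<open>q\<close> choices remain at each step: the margin \<open>5 * K + 1\<close> pays for at most
  \<open>4 * K\<close> used elements and \<open>K + 1\<close> coincidences at the neighbouring
  junction. \<open>few\<close> bounds the number of interval events.\<close>

locale layered_blocks =
  fixes m :: int and K s q :: nat and D :: "nat \<Rightarrow> int set" and Z C0 C1 :: "int set"
  assumes K: "K > 0" and s: "s \<ge> 2"
    and dissoc: "\<And>i. i < s \<Longrightarrow> dissociated m (D i)"
    and disj: "\<And>i j. i < s \<Longrightarrow> j < s \<Longrightarrow> i \<noteq> j \<Longrightarrow> D i \<inter> D j = {}"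
    and large: "\<And>i. i < s \<Longrightarrow> 2 ^ 20 * K \<le> card (D i)"
    and q16: "\<And>i. i < s \<Longrightarrow> card (D i) \<le> 16 * q"
    and qD: "\<And>i. i < s \<Longrightarrow> q + 5 * K + 1 \<le> card (D i)"
    and finZ: "finite Z"
    and total_nonzero: "\<not> m dvd (\<Sum>i<s. \<Sum>(D i))"
    and total_Z: "\<And>z. z \<in> Z \<Longrightarrow> \<not> [(\<Sum>i<s. \<Sum>(D i)) = z] (mod m)"
    and C0: "C0 \<subseteq> D 0"
      "\<And>S. S \<subseteq> C0 \<Longrightarrow> card S < K \<Longrightarrow> q + 5 * K + 1 \<le> card {y \<in> C0. \<forall>z\<in>Z. \<not> [\<Sum>S + y = z] (mod m)}"
    and C1: "C1 \<subseteq> D (s - 1)"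
      "\<And>S. S \<subseteq> C1 \<Longrightarrow> card S < K \<Longrightarrow>
        q + 5 * K + 1 \<le> card {y \<in> C1. \<forall>z\<in>Z. \<not> [(\<Sum>i<s. \<Sum>(D i)) - (\<Sum>S + y) = z] (mod m)}"
    and few: "(\<Sum>i<s. card (D i)) ^ 2 * (card Z + 1) < 16 ^ K"
begin

definition T0 :: int where "T0 = (\<Sum>i<s. \<Sum>(D i))"

text \<open>Pieces are numbered from 0 to \<open>2 * s - 1\<close>; for \<open>g < s\<close> the
  pieces \<open>g\<close> and \<open>g + s\<close> are the two layers of the same block.\<close>

definition piece :: "(nat \<Rightarrow> int list) \<Rightarrow> nat \<Rightarrow> int list" where
  "piece \<rho> g = layer K (g div s) (\<rho> (g mod s))"

definition head :: "(nat \<Rightarrow> int list) \<Rightarrow> nat \<Rightarrow> nat \<Rightarrow> int" where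
  "head \<rho> g k = sum_list (take k (piece \<rho> g))"

definition tail :: "(nat \<Rightarrow> int list) \<Rightarrow> nat \<Rightarrow> nat \<Rightarrow> int" where
  "tail \<rho> g k = sum_list (take k (rev (piece \<rho> g)))"

text \<open>The junctions are cyclic: an interval missing only a few elements at either end of the word
  is controlled by its complement, whose sum must avoid the total.\<close>

definition prv :: "nat \<Rightarrow> nat" where "prv g = (if g = 0 then 2 * s - 1 else g - 1)"
definition nxt :: "nat \<Rightarrow> nat" where "nxt g = (if g = 2 * s - 1 then 0 else g + 1)"
definition target :: "nat \<Rightarrow> int" where "target g = (if g = 0 then T0 else 0)"

text \<open>\<open>v\<close> is a sum of elements at end \<open>e\<close> of block \<open>i\<close>,
  an end of piece \<open>g\<close>. It is bad if it completes to the target with at most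
  \<open>K\<close> elements across the junction, possibly none, or if it puts a prefix sum into
  \<open>Z\<close> at an extreme end of the word.\<close>

definition bad :: "(nat \<Rightarrow> int list) \<Rightarrow> nat \<Rightarrow> nat \<Rightarrow> int \<Rightarrow> bool" where
  "bad \<rho> i e v \<longleftrightarrow> (let g = i + (e div 2) * s in
     if even e then (\<exists>k\<le>K. [tail \<rho> (prv g) k + v = target g] (mod m)) \<or> (g = 0 \<and> (\<exists>z\<in>Z. [v = z] (mod m)))
     else (\<exists>k\<le>K. [v + head \<rho> (nxt g) k = target (nxt g)] (mod m)) \<or>
       (g = 2 * s - 1 \<and> (\<exists>z\<in>Z. [T0 - v = z] (mod m))))"

definition good_lists :: "(nat \<Rightarrow> int list) \<Rightarrow> nat \<Rightarrow> int list set" where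
  "good_lists \<rho> i = {\<tau> \<in> permutations_of_set (D i). \<forall>e<4. \<forall>k\<in>{1..K}. \<not> bad \<rho> i e (sum_list (take k (block_end K e \<tau>)))}"

text \<open>Relative to a set \<open>A\<close> of blocks, since the conditions are established one
  block at a time: a condition counts once all blocks it draws elements from are in
  \<open>A\<close>. For \<open>A = {..<s}\<close> it is the restriction under which lists are
  resampled.\<close>

definition valid :: "nat set \<Rightarrow> (nat \<Rightarrow> int list) \<Rightarrow> bool" where
  "valid A \<rho> \<longleftrightarrow>
    (\<forall>g<2 * s. \<forall>k\<le>K. \<forall>l\<le>K. k > 0 \<or> l > 0 \<longrightarrow> (k > 0 \<longrightarrow> prv g mod s \<in> A) \<longrightarrow> (l > 0 \<longrightarrow> g mod s \<in> A) \<longrightarrow>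
      \<not> [tail \<rho> (prv g) k + head \<rho> g l = target g] (mod m)) \<and>
    (0 \<in> A \<longrightarrow> (\<forall>k\<in>{1..K}. \<forall>z\<in>Z. \<not> [head \<rho> 0 k = z] (mod m))) \<and>
    (s - 1 \<in> A \<longrightarrow> (\<forall>k\<in>{1..K}. \<forall>z\<in>Z. \<not> [T0 - tail \<rho> (2 * s - 1) k = z] (mod m)))"

definition orders :: "(nat \<Rightarrow> int list) set" where
  "orders = PiE {..<s} (\<lambda>i. permutations_of_set (D i))"

section \<open>Replacing one list and counting the good replacements\<close>

lemma finD: "i < s \<Longrightarrow> finite (D i)"
  using dissoc dissociated_finite by blast

lemma card_ge: "i < s \<Longrightarrow> 4 * K < card (D i)"
  using large[of i] K by simp

lemma block_index:
  assumes "g < 2 * s"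
  shows "g mod s + (2 * (g div s) div 2) * s = g" "2 * (g div s) < 4" "2 * (g div s) + 1 < 4"
    "g mod s + ((2 * (g div s) + 1) div 2) * s = g" "g mod s < s"
proof -
  have "g div s < 2" using assms by (simp add: less_mult_imp_div_less)
  then show "2 * (g div s) < 4" "2 * (g div s) + 1 < 4" by linarith+
  show "g mod s < s" using s by simp
qed simp_all

text \<open>Ensures that replacing one list alters at most one side of each junction; this relies on
  \<open>s \<ge> 2\<close>.\<close>

lemma prv_block:
  assumes g: "g < 2 * s"
  shows "prv g < 2 * s \<and> prv g mod s \<noteq> g mod s \<and> nxt (prv g) = g"
proof (cases "g = 0")
  case True
  have "2 * s - 1 = s + (s - 1)" using s by simp
  then have "(2 * s - 1) mod s = (s - 1) mod s" by (metis mod_add_self1)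
  then show ?thesis using True s by (simp add: prv_def nxt_def)
next
  case False
  have "(g - 1) mod s \<noteq> g mod s"
  proof
    assume "(g - 1) mod s = g mod s"
    then have "s dvd g - (g - 1)" using mod_eq_dvd_iff_nat[of "g - 1" g s] by simp
    then have "s dvd 1" using False by simp
    then show False using s by simp
  qed
  moreover have "g - 1 < 2 * s" "g - 1 \<noteq> 2 * s - 1" "g - 1 + 1 = g" using g False by linarith+
  ultimately show ?thesis using False by (simp add: prv_def nxt_def)
qed

lemma piece_upd: "piece (\<rho>(i := \<tau>)) g = (if g mod s = i then layer K (g div s) \<tau> else piece \<rho> g)"
  by (simp add: piece_def)

text \<open>A good list excludes every coincidence with the current neighbours, including an empty
  contribution from them; conditions that draw no elements from block \<open>i\<close> are
  inherited.\<close>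

lemma valid_upd:
  assumes v: "valid A \<rho>" and \<tau>: "\<tau> \<in> good_lists \<rho> i"
  shows "valid (insert i A) (\<rho>(i := \<tau>))"
proof -
  let ?\<rho> = "\<rho>(i := \<tau>)"
  have good: "\<not> bad \<rho> i e (sum_list (take k (block_end K e \<tau>)))" if "e < 4" "k \<in> {1..K}" for e k
    using \<tau> that unfolding good_lists_def by blast
  have hd_new: "head ?\<rho> g k = sum_list (take k (block_end K (2 * (g div s)) \<tau>))" if "g mod s = i" for g k
    using that by (simp add: head_def piece_upd block_end_def)
  have tl_new: "tail ?\<rho> g k = sum_list (take k (block_end K (2 * (g div s) + 1) \<tau>))" if "g mod s = i" for g k
    using that by (simp add: tail_def piece_upd block_end_def)
  have hd_old: "head ?\<rho> g k = head \<rho> g k" if "g mod s \<noteq> i \<or> k = 0" for g k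
    using that by (auto simp: head_def piece_upd)
  have tl_old: "tail ?\<rho> g k = tail \<rho> g k" if "g mod s \<noteq> i \<or> k = 0" for g k
    using that by (auto simp: tail_def piece_upd)
  have "\<not> [tail ?\<rho> (prv g) k + head ?\<rho> g l = target g] (mod m)"
    if h: "g < 2 * s" "k \<le> K" "l \<le> K" "k > 0 \<or> l > 0" "k > 0 \<longrightarrow> prv g mod s \<in> insert i A" "l > 0 \<longrightarrow> g mod s \<in> insert i A" for g k l
  proof -
    note pb = prv_block[OF h(1)]
    consider "g mod s = i" "l > 0" | "prv g mod s = i" "k > 0"
      | "g mod s \<noteq> i \<or> l = 0" "prv g mod s \<noteq> i \<or> k = 0" by blast
    then show ?thesis
    proof cases
      case 1
      have "prv g mod s \<noteq> i" using pb 1(1) by simp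
      then have t: "tail ?\<rho> (prv g) k = tail \<rho> (prv g) k" by (simp add: tl_old)
      have "\<not> bad \<rho> i (2 * (g div s)) (head ?\<rho> g l)"
        unfolding hd_new[OF 1(1)] using block_index[OF h(1)] 1(2) h(3) by (intro good) auto
      moreover have "i + (2 * (g div s) div 2) * s = g" using block_index[OF h(1)] 1(1) by simp
      ultimately show ?thesis using h(2) t by (auto simp: bad_def Let_def)
    next
      case 2
      have "g mod s \<noteq> i" using pb 2(1) by simp
      then have t: "head ?\<rho> g l = head \<rho> g l" by (simp add: hd_old)
      have p: "prv g < 2 * s" using pb by simp
      have "\<not> bad \<rho> i (2 * (prv g div s) + 1) (tail ?\<rho> (prv g) k)"
        unfolding tl_new[OF 2(1)] using block_index[OF p] 2(2) h(2) by (intro good) auto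
      moreover have "i + ((2 * (prv g div s) + 1) div 2) * s = prv g" using block_index[OF p] 2(1) by simp
      ultimately show ?thesis using h(3) t pb by (auto simp: bad_def Let_def)
    next
      case 3
      have "\<not> [tail \<rho> (prv g) k + head \<rho> g l = target g] (mod m)"
        using v h 3 unfolding valid_def by blast
      then show ?thesis using hd_old[OF 3(1)] tl_old[OF 3(2)] by simp
    qed
  qed
  moreover have "\<not> [head ?\<rho> 0 k = z] (mod m)" if h: "0 \<in> insert i A" "k \<in> {1..K}" "z \<in> Z" for k z
  proof (cases "i = 0")
    case True
    then have "\<not> bad \<rho> i 0 (head ?\<rho> 0 k)" using hd_new[of 0 k] good[of 0 k] h(2) by simp
    then show ?thesis using True h(3) by (auto simp: bad_def Let_def)
  next
    case False
    then have "\<not> [head \<rho> 0 k = z] (mod m)" using v h unfolding valid_def by blast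
    then show ?thesis using hd_old[of 0 k] False by simp
  qed
  moreover have "\<not> [T0 - tail ?\<rho> (2 * s - 1) k = z] (mod m)" if h: "s - 1 \<in> insert i A" "k \<in> {1..K}" "z \<in> Z" for k z
  proof -
    have md: "(2 * s - 1) mod s = s - 1" "(2 * s - 1) div s = 1"
    proof -
      have e: "2 * s - 1 = (s - 1) + 1 * s" using s by simp
      show "(2 * s - 1) mod s = s - 1" unfolding e mod_mult_self1 using s by simp
      show "(2 * s - 1) div s = 1" unfolding e using s by (subst div_mult_self1) simp_all
    qed
    show ?thesis
    proof (cases "i = s - 1")
      case True
      then have "\<not> bad \<rho> i 3 (tail ?\<rho> (2 * s - 1) k)" using tl_new[of "2 * s - 1" k] good[of 3 k] h(2) md by simp
      moreover have "i + (3 div 2) * s = 2 * s - 1" using True s by simp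
      ultimately show ?thesis using h(3) by (auto simp: bad_def Let_def)
    next
      case False
      then have "\<not> [T0 - tail \<rho> (2 * s - 1) k = z] (mod m)" using v h unfolding valid_def by blast
      then show ?thesis using tl_old[of "2 * s - 1" k] False md by simp
    qed
  qed
  ultimately show ?thesis unfolding valid_def by blast
qed

lemma card_good_lists:
  assumes i: "i < s"
  shows "q ^ (4 * K) * fact (card (D i) - 4 * K) \<le> card (good_lists \<rho> i)"
proof -
  \<comment> \<open>End 0 of block 0 starts the word and end 3 of block \<open>s - 1\<close>
    finishes it; only these two must avoid \<open>Z\<close>, so only they use restricted
    pools.\<close>
  define C :: "nat \<Rightarrow> int set" where "C = (\<lambda>e. if i = 0 \<and> e = 0 then C0 else if i = s - 1 \<and> e = 3 then C1 else D i)"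
  have CD: "C e \<subseteq> D i" for e using C0(1) C1(1) by (auto simp: C_def)
  have "q + 4 * K \<le> card {y \<in> C e. \<not> bad \<rho> i e (\<Sum>S + y)}" if e: "e < 4" and S: "S \<subseteq> C e" "card S < K" for e S
  proof -
    define g where "g = i + (e div 2) * s"
    define w where "w = (\<lambda>k. if even e then target g - tail \<rho> (prv g) k - \<Sum>S else target (nxt g) - head \<rho> (nxt g) k - \<Sum>S)"
    define U where "U = {y \<in> C e. \<not> (even e \<and> g = 0 \<and> (\<exists>z\<in>Z. [\<Sum>S + y = z] (mod m))) \<and>
        \<not> (odd e \<and> g = 2 * s - 1 \<and> (\<exists>z\<in>Z. [T0 - (\<Sum>S + y) = z] (mod m)))}"
    \<comment> \<open>The elements creating a coincidence at the junction: each of the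
      \<open>K + 1\<close> lengths on the other side prescribes the residue of \<open>y\<close>,
      which at most one element of the dissociated \<open>D i\<close> attains.\<close>
    define R where "R = (\<Union>k\<le>K. {y \<in> D i. [y = w k] (mod m)})"
    have "q + 5 * K + 1 \<le> card U"
    proof -
      have e4: "e = 0 \<or> e = 1 \<or> e = 2 \<or> e = 3" using e by linarith
      consider "i = 0" "e = 0" | "i = s - 1" "e = 3" | "\<not> (even e \<and> g = 0)" "\<not> (odd e \<and> g = 2 * s - 1)"
        "\<not> (i = 0 \<and> e = 0)" "\<not> (i = s - 1 \<and> e = 3)"
        using e4 i s by (fastforce simp: g_def)
      then show ?thesis
      proof cases
        case 1
        then have "U = {y \<in> C0. \<forall>z\<in>Z. \<not> [\<Sum>S + y = z] (mod m)}" by (auto simp: U_def C_def g_def)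
        then show ?thesis using C0(2)[of S] S 1 by (simp add: C_def)
      next
        case 2
        then have "g = 2 * s - 1" using s by (simp add: g_def)
        then have "U = {y \<in> C1. \<forall>z\<in>Z. \<not> [T0 - (\<Sum>S + y) = z] (mod m)}" using 2 s by (auto simp: U_def C_def)
        moreover have "C e = C1" using 2 s by (simp add: C_def)
        ultimately show ?thesis using C1(2)[of S] S by (simp add: T0_def)
      next
        case 3
        then have "U = D i" by (auto simp: U_def C_def)
        then show ?thesis using qD[OF i] by simp
      qed
    qed
    moreover have "U \<subseteq> {y \<in> C e. \<not> bad \<rho> i e (\<Sum>S + y)} \<union> R"
    proof
      fix y assume y: "y \<in> U"
      have yD: "y \<in> D i" "y \<in> C e" using y CD by (auto simp: U_def)
      have "y \<in> R" if bd: "bad \<rho> i e (\<Sum>S + y)"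
      proof (cases "even e")
        case True
        then obtain k where "k \<le> K" "[tail \<rho> (prv g) k + (\<Sum>S + y) = target g] (mod m)"
          using bd y by (auto simp: bad_def Let_def U_def g_def[symmetric])
        then show ?thesis using yD True by (auto simp: R_def w_def cong_iff_dvd_diff algebra_simps intro!: bexI[of _ k])
      next
        case False
        then obtain k where "k \<le> K" "[(\<Sum>S + y) + head \<rho> (nxt g) k = target (nxt g)] (mod m)"
          using bd y by (auto simp: bad_def Let_def U_def g_def[symmetric])
        then show ?thesis using yD False by (auto simp: R_def w_def cong_iff_dvd_diff algebra_simps intro!: bexI[of _ k])
      qed
      then show "y \<in> {y \<in> C e. \<not> bad \<rho> i e (\<Sum>S + y)} \<union> R" using yD by blast
    qed
    then have "card U \<le> card ({y \<in> C e. \<not> bad \<rho> i e (\<Sum>S + y)} \<union> R)"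
      using finD[OF i] finite_subset[OF CD finD[OF i], of e] by (intro card_mono) (auto simp: R_def)
    moreover have "card ({y \<in> C e. \<not> bad \<rho> i e (\<Sum>S + y)} \<union> R) \<le> card {y \<in> C e. \<not> bad \<rho> i e (\<Sum>S + y)} + card R"
      by (rule card_Un_le)
    moreover have "card R \<le> K + 1"
    proof -
      have "card R \<le> (\<Sum>k\<le>K. card {y \<in> D i. [y = w k] (mod m)})" unfolding R_def by (rule card_UN_le) simp
      also have "\<dots> \<le> (\<Sum>k\<le>K. 1)"
      proof (rule sum_mono)
        fix k
        show "card {y \<in> D i. [y = w k] (mod m)} \<le> 1"
        proof (rule card_le_Suc0_iff_eq[THEN iffD2, folded One_nat_def])
          show "\<forall>a1\<in>{y \<in> D i. [y = w k] (mod m)}. \<forall>a2\<in>{y \<in> D i. [y = w k] (mod m)}. a1 = a2"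
            using dissociated_cong_eq[OF dissoc[OF i]] cong_sym cong_trans by blast
        qed (use finD[OF i] in simp)
      qed
      finally show ?thesis by simp
    qed
    ultimately show ?thesis by linarith
  qed
  then show ?thesis
    unfolding good_lists_def
    by (intro card_perms_good_ends[where C = C]) (use finD[OF i] card_ge[OF i] K CD in auto)
qed

lemma good_lists_nonempty: "i < s \<Longrightarrow> good_lists \<rho> i \<noteq> {}"
proof -
  assume i: "i < s"
  have "q > 0" using q16[OF i] card_ge[OF i] by simp
  then have "0 < q ^ (4 * K) * fact (card (D i) - 4 * K)" by simp
  then have "card (good_lists \<rho> i) > 0" using card_good_lists[OF i, of \<rho>] by (rule less_le_trans)
  then show ?thesis by force
qed

text \<open>\<open>valid {}\<close> is vacuous, so arbitrary lists can be replaced by good ones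
  block by block.\<close>

lemma valid_orders_nonempty: "\<exists>\<rho>\<in>orders. valid {..<s} \<rho>"
proof -
  have "\<exists>\<rho>\<in>orders. valid {..<n} \<rho>" if "n \<le> s" for n
    using that
  proof (induction n)
    case 0
    have "orders \<noteq> {}"
      unfolding orders_def using finD by (auto simp: PiE_eq_empty_iff)
    moreover have "valid {} \<rho>" for \<rho> by (simp add: valid_def)
    ultimately show ?case by (metis ex_in_conv lessThan_0)
  next
    case (Suc n)
    then obtain \<rho> where \<rho>: "\<rho> \<in> orders" "valid {..<n} \<rho>" by auto
    obtain \<tau> where \<tau>: "\<tau> \<in> good_lists \<rho> n" using good_lists_nonempty[of n \<rho>] Suc.prems by auto
    have "\<rho>(n := \<tau>) \<in> orders"
      using \<rho>(1) \<tau> Suc.prems by (auto simp: orders_def good_lists_def PiE_iff extensional_def)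
    moreover have "valid {..<Suc n} (\<rho>(n := \<tau>))"
      using valid_upd[OF \<rho>(2) \<tau>] by (simp add: lessThan_Suc)
    ultimately show ?case by blast
  qed
  then show ?thesis by blast
qed

section \<open>Positions in the word and sums of intervals\<close>

definition plen :: "nat \<Rightarrow> nat" where
  "plen g = (if g div s = 0 then 2 * K else card (D (g mod s)) - 2 * K)"

definition off :: "nat \<Rightarrow> nat" where "off g = (\<Sum>d<g. plen d)"

definition word :: "(nat \<Rightarrow> int list) \<Rightarrow> int list" where
  "word \<rho> = concat (map (piece \<rho>) [0..<2 * s])"

definition psum :: "(nat \<Rightarrow> int list) \<Rightarrow> nat \<Rightarrow> int" where
  "psum \<rho> i = sum_list (take i (word \<rho>))"

lemma ordersD:
  assumes "\<rho> \<in> orders" "i < s"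
  shows "\<rho> i \<in> permutations_of_set (D i)" "length (\<rho> i) = card (D i)" "set (\<rho> i) = D i" "distinct (\<rho> i)"
proof -
  show "\<rho> i \<in> permutations_of_set (D i)" using assms by (auto simp: orders_def)
  then show "length (\<rho> i) = card (D i)" "set (\<rho> i) = D i" "distinct (\<rho> i)"
    by (simp_all add: length_finite_permutations_of_set permutations_of_setD)
qed

lemma length_layer:
  assumes "i < s" "\<tau> \<in> permutations_of_set (D i)"
  shows "length (layer K 0 \<tau>) = 2 * K" "h > 0 \<Longrightarrow> length (layer K h \<tau>) = card (D i) - 2 * K"
  using card_ge[OF assms(1)] length_finite_permutations_of_set[OF assms(2)] by (simp_all add: layer_def)

lemma length_piece:
  assumes "\<rho> \<in> orders"
  shows "length (piece \<rho> g) = plen g"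
proof -
  have "g mod s < s" using s by simp
  then show ?thesis
    using length_layer(1)[OF _ ordersD(1)[OF assms]] length_layer(2)[OF _ ordersD(1)[OF assms], of "g mod s" "g div s"]
    by (cases "g div s = 0") (simp_all add: piece_def plen_def)
qed

lemma plen_ge: "2 * K \<le> plen g"
  using card_ge[of "g mod s"] s by (auto simp: plen_def)

lemma sum_two_layers: "(\<Sum>g<2 * s. f g) = (\<Sum>i<s. f i + f (s + i))" for f :: "nat \<Rightarrow> 'a::comm_monoid_add"
proof -
  have "(\<Sum>g<2 * s. f g) = (\<Sum>g<s. f g) + (\<Sum>g=s..<s + s. f g)"
    by (metis add.commute lessThan_atLeast0 mult_2 sum.atLeastLessThan_concat zero_le le_add1)
  also have "(\<Sum>g=s..<s + s. f g) = (\<Sum>i<s. f (s + i))"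
    using sum.shift_bounds_nat_ivl[of f 0 s s] by (simp add: lessThan_atLeast0 add.commute)
  finally show ?thesis by (simp add: sum.distrib)
qed

lemma index_low: "i < s \<Longrightarrow> i div s = 0" "i < s \<Longrightarrow> i mod s = i"
  and index_high: "i < s \<Longrightarrow> (s + i) div s = 1" "i < s \<Longrightarrow> (s + i) mod s = i"
  using s by simp_all

lemma off_total: "off (2 * s) = (\<Sum>i<s. card (D i))"
  unfolding off_def sum_two_layers
  by (intro sum.cong) (use card_ge in \<open>fastforce simp: plen_def index_low index_high\<close>)+

lemma off_mono: "a \<le> b \<Longrightarrow> off a \<le> off b"
  unfolding off_def by (intro sum_mono2) auto

lemma length_word:
  assumes "\<rho> \<in> orders"
  shows "length (word \<rho>) = (\<Sum>i<s. card (D i))"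
proof -
  have "length (word \<rho>) = (\<Sum>g<2 * s. length (piece \<rho> g))"
    unfolding word_def by (simp add: length_concat o_def sum_list_distinct_conv_sum_set atLeast0LessThan)
  then show ?thesis using off_total by (simp add: length_piece[OF assms] off_def)
qed

lemma mset_word:
  assumes "\<rho> \<in> orders"
  shows "mset (word \<rho>) = (\<Sum>i<s. mset (\<rho> i))"
proof -
  have "mset (concat (map f [0..<n])) = (\<Sum>g<n. mset (f g))" for f :: "nat \<Rightarrow> int list" and n
    by (induction n) simp_all
  then have "mset (word \<rho>) = (\<Sum>g<2 * s. mset (piece \<rho> g))" by (simp add: word_def)
  also have "\<dots> = (\<Sum>i<s. mset (piece \<rho> i) + mset (piece \<rho> (s + i)))" by (rule sum_two_layers)
  also have "\<dots> = (\<Sum>i<s. mset (\<rho> i))"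
  proof (rule sum.cong)
    fix i assume "i \<in> {..<s}"
    then have "piece \<rho> i = take (2 * K) (\<rho> i)" "piece \<rho> (s + i) = drop (2 * K) (\<rho> i)"
      by (simp_all add: piece_def layer_def index_low index_high)
    then show "mset (piece \<rho> i) + mset (piece \<rho> (s + i)) = mset (\<rho> i)"
      by (metis append_take_drop_id mset_append)
  qed simp
  finally show ?thesis .
qed

lemma set_word: "\<rho> \<in> orders \<Longrightarrow> set (word \<rho>) = (\<Union>i<s. D i)"
  using arg_cong[OF mset_word, of \<rho> set_mset] ordersD(3)[of \<rho>] by (simp add: set_mset_sum)

lemma distinct_word:
  assumes "\<rho> \<in> orders"
  shows "distinct (word \<rho>)"
proof -
  have "card (set (word \<rho>)) = (\<Sum>i<s. card (D i))"
    unfolding set_word[OF assms] using disj finD by (intro card_UN_disjoint) auto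
  then show ?thesis using length_word[OF assms] by (simp add: card_distinct)
qed

lemma locate_start:
  assumes "i < off n"
  shows "\<exists>a k. a < n \<and> k < plen a \<and> i = off a + k"
  using assms
proof (induction n)
  case (Suc n)
  show ?case
  proof (cases "i < off n")
    case True
    then show ?thesis using Suc.IH less_Suc_eq by blast
  next
    case False
    then show ?thesis using Suc.prems by (intro exI[of _ n] exI[of _ "i - off n"]) (auto simp: off_def)
  qed
qed (simp add: off_def)

lemma locate_end:
  assumes "0 < j" "j \<le> off n"
  shows "\<exists>b l. b < n \<and> 0 < l \<and> l \<le> plen b \<and> j = off b + l"
proof -
  have "j - 1 < off n" using assms by linarith
  then obtain b k where "b < n" "k < plen b" "j - 1 = off b + k" using locate_start by blast
  then show ?thesis using assms(1) by (intro exI[of _ b] exI[of _ "Suc k"]) auto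
qed

lemma psum_eq:
  assumes \<rho>: "\<rho> \<in> orders" and a: "a < 2 * s" "k \<le> plen a"
  shows "psum \<rho> (off a + k) = (\<Sum>d<a. sum_list (piece \<rho> d)) + head \<rho> a k"
proof -
  have o: "(\<Sum>e<d. length (piece \<rho> e)) = off d" for d
    by (simp add: off_def length_piece[OF \<rho>])
  have "psum \<rho> (off a + k) = (\<Sum>d<2 * s. sum_list (take (off a + k - off d) (piece \<rho> d)))"
    unfolding psum_def word_def sum_list_take_concat o ..
  also have "{..<2 * s} = {..<a} \<union> ({a} \<union> {a<..<2 * s})" using a(1) by auto
  also have "(\<Sum>d\<in>{..<a} \<union> ({a} \<union> {a<..<2 * s}). sum_list (take (off a + k - off d) (piece \<rho> d))) =
    (\<Sum>d<a. sum_list (take (off a + k - off d) (piece \<rho> d))) +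
    (sum_list (take (off a + k - off a) (piece \<rho> a)) + (\<Sum>d\<in>{a<..<2 * s}. sum_list (take (off a + k - off d) (piece \<rho> d))))"
    by (subst sum.union_disjoint; (subst sum.union_disjoint)?) auto
  also have "(\<Sum>d\<in>{a<..<2 * s}. sum_list (take (off a + k - off d) (piece \<rho> d))) = 0"
  proof (rule sum.neutral, rule ballI)
    fix d assume "d \<in> {a<..<2 * s}"
    then have "off (Suc a) \<le> off d" by (intro off_mono) simp
    then have "off a + k - off d = 0" using a(2) by (simp add: off_def)
    then show "sum_list (take (off a + k - off d) (piece \<rho> d)) = 0" by simp
  qed
  also have "(\<Sum>d<a. sum_list (take (off a + k - off d) (piece \<rho> d))) = (\<Sum>d<a. sum_list (piece \<rho> d))"
  proof (rule sum.cong)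
    fix d assume "d \<in> {..<a}"
    then have "off (Suc d) \<le> off a" by (intro off_mono) simp
    then have "length (piece \<rho> d) \<le> off a + k - off d" by (simp add: off_def length_piece[OF \<rho>])
    then show "sum_list (take (off a + k - off d) (piece \<rho> d)) = sum_list (piece \<rho> d)" by simp
  qed simp
  finally show ?thesis by (simp add: head_def)
qed

lemma tail_eq:
  assumes "\<rho> \<in> orders" "r \<le> plen g"
  shows "tail \<rho> g r = sum_list (piece \<rho> g) - head \<rho> g (plen g - r)"
  using assms by (simp add: tail_def head_def sum_list_take_rev length_piece)

lemma sum_pieces: "\<rho> \<in> orders \<Longrightarrow> (\<Sum>g<2 * s. sum_list (piece \<rho> g)) = T0"
proof -
  assume \<rho>: "\<rho> \<in> orders"
  have "(\<Sum>g<2 * s. sum_list (piece \<rho> g)) = (\<Sum>i<s. sum_list (piece \<rho> i) + sum_list (piece \<rho> (s + i)))"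
    by (rule sum_two_layers)
  also have "\<dots> = (\<Sum>i<s. \<Sum>(D i))"
  proof (rule sum.cong)
    fix i assume "i \<in> {..<s}"
    then have i: "i < s" by simp
    then have "piece \<rho> i = take (2 * K) (\<rho> i)" "piece \<rho> (s + i) = drop (2 * K) (\<rho> i)"
      by (simp_all add: piece_def layer_def index_low index_high)
    moreover have "sum_list (\<rho> i) = \<Sum>(D i)" using ordersD(3,4)[OF \<rho> i] distinct_sum_list_conv_Sum by metis
    ultimately show "sum_list (piece \<rho> i) + sum_list (piece \<rho> (s + i)) = \<Sum>(D i)"
      by (metis append_take_drop_id sum_list_append)
  qed simp
  finally show ?thesis by (simp add: T0_def)
qed

text \<open>The part of piece \<open>g\<close>, a layer of the list \<open>\<tau>\<close>, in the interval from offset \<open>k\<close> of piece \<open>a\<close>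
  to offset \<open>l\<close> of piece \<open>b\<close>.\<close>

definition part :: "nat \<Rightarrow> nat \<Rightarrow> nat \<Rightarrow> nat \<Rightarrow> nat \<Rightarrow> int list \<Rightarrow> int" where
  "part a k b l g \<tau> =
    ((if g < b then sum_list (layer K (g div s) \<tau>) else if g = b then sum_list (take l (layer K (g div s) \<tau>)) else 0) -
     (if g < a then sum_list (layer K (g div s) \<tau>) else if g = a then sum_list (take k (layer K (g div s) \<tau>)) else 0))"

text \<open>Grouping an interval sum by blocks isolates its dependence on a single list.\<close>

lemma psum_diff_parts:
  assumes \<rho>: "\<rho> \<in> orders" and a: "a < 2 * s" "k \<le> plen a" and b: "b < 2 * s" "l \<le> plen b"
  shows "psum \<rho> (off b + l) - psum \<rho> (off a + k) = (\<Sum>i<s. part a k b l i (\<rho> i) + part a k b l (s + i) (\<rho> i))"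
proof -
  have cut: "(\<Sum>d<c. f d) + h = (\<Sum>g<2 * s. if g < c then f g else if g = c then h else 0)" if "c < 2 * s"
    for c h and f :: "nat \<Rightarrow> int"
  proof -
    have "(\<Sum>g<2 * s. if g < c then f g else if g = c then h else 0) =
      (\<Sum>g<2 * s. (if g \<in> {..<c} then f g else 0) + (if g = c then h else 0))" by (intro sum.cong) auto
    also have "\<dots> = (\<Sum>g\<in>{..<2 * s} \<inter> {..<c}. f g) + (\<Sum>g<2 * s. if g = c then h else 0)"
      by (simp add: sum.distrib sum.inter_restrict)
    also have "{..<2 * s} \<inter> {..<c} = {..<c}" using that by auto
    finally show ?thesis using that by simp
  qed
  have "psum \<rho> (off b + l) - psum \<rho> (off a + k) = (\<Sum>g<2 * s. part a k b l g (\<rho> (g mod s)))"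
    unfolding psum_eq[OF \<rho> a] psum_eq[OF \<rho> b] cut[OF a(1)] cut[OF b(1)] sum_subtractf[symmetric]
    by (intro sum.cong) (auto simp: part_def piece_def head_def)
  also have "\<dots> = (\<Sum>i<s. part a k b l i (\<rho> (i mod s)) + part a k b l (s + i) (\<rho> ((s + i) mod s)))"
    by (rule sum_two_layers)
  finally show ?thesis by simp
qed

text \<open>With the other lists fixed, the interval sum is an infix sum of the list of block
  \<open>c\<close> plus a constant \<open>R\<close>, so the count for infix sums applies with a
  shifted target.\<close>

lemma card_interval_event:
  assumes \<rho>: "\<rho> \<in> orders" and a: "a < 2 * s" "k \<le> plen a" and b: "b < 2 * s" "l \<le> plen b"
    and c: "c < s" "u + n \<le> card (D c)"
    and contr: "\<And>\<tau>. \<tau> \<in> permutations_of_set (D c) \<Longrightarrow>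
      part a k b l c \<tau> + part a k b l (s + c) \<tau> = sum_list (take n (drop u \<tau>))"
  shows "card {\<tau> \<in> permutations_of_set (D c).
      [psum (\<rho>(c := \<tau>)) (off b + l) - psum (\<rho>(c := \<tau>)) (off a + k) = z] (mod m)} \<le> fact n * fact (card (D c) - n)"
proof -
  define F where "F = (\<lambda>i \<tau>. part a k b l i \<tau> + part a k b l (s + i) \<tau>)"
  define R where "R = (\<Sum>i\<in>{..<s} - {c}. F i (\<rho> i))"
  have "psum (\<rho>(c := \<tau>)) (off b + l) - psum (\<rho>(c := \<tau>)) (off a + k) = sum_list (take n (drop u \<tau>)) + R"
    if \<tau>: "\<tau> \<in> permutations_of_set (D c)" for \<tau>
  proof -
    have "\<rho>(c := \<tau>) \<in> orders" using \<rho> \<tau> c(1) by (auto simp: orders_def PiE_iff extensional_def)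
    then have "psum (\<rho>(c := \<tau>)) (off b + l) - psum (\<rho>(c := \<tau>)) (off a + k) = (\<Sum>i<s. F i ((\<rho>(c := \<tau>)) i))"
      using psum_diff_parts a b unfolding F_def by blast
    also have "\<dots> = F c ((\<rho>(c := \<tau>)) c) + (\<Sum>i\<in>{..<s} - {c}. F i ((\<rho>(c := \<tau>)) i))"
      using c(1) by (intro sum.remove) auto
    also have "(\<Sum>i\<in>{..<s} - {c}. F i ((\<rho>(c := \<tau>)) i)) = R" unfolding R_def by (intro sum.cong) auto
    finally show ?thesis by (simp only: F_def fun_upd_same contr[OF \<tau>])
  qed
  then have "{\<tau> \<in> permutations_of_set (D c). [psum (\<rho>(c := \<tau>)) (off b + l) - psum (\<rho>(c := \<tau>)) (off a + k) = z] (mod m)}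
    = {\<tau> \<in> permutations_of_set (D c). [sum_list (take n (drop u \<tau>)) = z - R] (mod m)}"
    by (auto simp: cong_iff_dvd_diff algebra_simps)
  then show ?thesis using card_perms_with_infix_sum[OF dissoc[OF c(1)] c(2)] by simp
qed

text \<open>Either every valid choice excludes the value \<open>z\<close>, or some block
  \<open>c\<close> has between \<open>K\<close> and \<open>card (D c) - K\<close> elements in the
  interval, contiguous in its list, and the count for infix sums applies. The cases follow the
  distance between the pieces \<open>a\<close> and \<open>b\<close> of the endpoints.\<close>

lemma interval_dichotomy:
  assumes a: "a < 2 * s" "k < plen a" and b: "b < 2 * s" "0 < l" "l \<le> plen b"
    and lt: "off a + k < off b + l" and z: "z = 0 \<or> z \<in> Z \<and> a = 0 \<and> k = 0"
  shows "(\<forall>\<rho>\<in>orders. valid {..<s} \<rho> \<longrightarrow> \<not> [psum \<rho> (off b + l) - psum \<rho> (off a + k) = z] (mod m)) \<or>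
    (\<exists>c n. c < s \<and> K \<le> n \<and> n + K \<le> card (D c) \<and> (\<forall>\<rho>\<in>orders.
      card {\<tau> \<in> permutations_of_set (D c). [psum (\<rho>(c := \<tau>)) (off b + l) - psum (\<rho>(c := \<tau>)) (off a + k) = z] (mod m)}
        \<le> fact n * fact (card (D c) - n)))" (is "?short \<or> ?long")
proof -
  have s0: "0 < s" using s by simp
  have long: ?long if "c < s" "K \<le> n" "n + K \<le> card (D c)" "u + n \<le> card (D c)"
    "\<And>\<tau>. \<tau> \<in> permutations_of_set (D c) \<Longrightarrow> part a k b l c \<tau> + part a k b l (s + c) \<tau> = sum_list (take n (drop u \<tau>))"
    for c n u
    using card_interval_event[OF _ a(1) _ b(1,3) that(1,4,5)] a(2) that(1-3) by (intro exI[of _ c] exI[of _ n]) simp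
  have len: "length \<tau> = card (D c)" if "\<tau> \<in> permutations_of_set (D c)" for \<tau> c
    using that by (rule length_finite_permutations_of_set)
  have ab: "a \<le> b"
  proof (rule ccontr)
    assume "\<not> a \<le> b"
    then have "off (Suc b) \<le> off a" by (intro off_mono) simp
    then show False using lt b(3) by (simp add: off_def)
  qed
  have diff: "psum \<rho> (off b + l) - psum \<rho> (off a + k) =
      (\<Sum>d<b. sum_list (piece \<rho> d)) + head \<rho> b l - (\<Sum>d<a. sum_list (piece \<rho> d)) - head \<rho> a k" if "\<rho> \<in> orders" for \<rho>
    using psum_eq[OF that a(1), of k] psum_eq[OF that b(1), of l] a(2) b(3) by simp
  have plow: "plen g = 2 * K" if "g < s" for g using that by (simp add: plen_def)
  have phigh: "plen (s + c) = card (D c) - 2 * K" if "c < s" for c using that by (simp add: plen_def index_high)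
  consider "a = b" | "b = a + 1" | "b \<ge> a + 2" "\<not> (a = 0 \<and> b = 2 * s - 1)" | "a = 0" "b = 2 * s - 1" "b \<ge> a + 2"
    using ab by linarith
  then show ?thesis
  proof cases
    case 1
    have kl: "k < l" using lt 1 by simp
    show ?thesis
    proof (cases "z = 0")
      case True
      have "\<not> [psum \<rho> (off b + l) - psum \<rho> (off a + k) = z] (mod m)" if \<rho>: "\<rho> \<in> orders" for \<rho>
      proof -
        define xs where "xs = take (l - k) (drop k (piece \<rho> a))"
        have c: "a mod s < s" using s0 by simp
        have "take l (piece \<rho> a) = take k (piece \<rho> a) @ xs" using kl unfolding xs_def by (metis le_add_diff_inverse less_imp_le take_add)
        then have "psum \<rho> (off b + l) - psum \<rho> (off a + k) = sum_list xs"
          using diff[OF \<rho>] 1 by (simp add: head_def)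
        moreover have "xs \<noteq> []" using kl a(2) length_piece[OF \<rho>] by (simp add: xs_def)
        moreover have "distinct xs" "set xs \<subseteq> D (a mod s)"
        proof -
          have "distinct (piece \<rho> a)" "set (piece \<rho> a) \<subseteq> D (a mod s)"
            using ordersD(3,4)[OF \<rho> c] by (auto simp: piece_def layer_def dest: in_set_takeD in_set_dropD)
          then show "distinct xs" "set xs \<subseteq> D (a mod s)" by (auto simp: xs_def dest: in_set_takeD in_set_dropD)
        qed
        ultimately show ?thesis
          using dissociated_sum_nonzero[OF dissoc[OF c], of "set xs"] True distinct_sum_list_conv_Sum[of xs]
          by (simp add: cong_0_iff)
      qed
      then show ?thesis by blast
    next
      case False
      then have zZ: "z \<in> Z" "a = 0" "k = 0" using z by auto
      show ?thesis
      proof (cases "l \<le> K")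
        case True
        have "\<not> [psum \<rho> (off b + l) - psum \<rho> (off a + k) = z] (mod m)" if "\<rho> \<in> orders" "valid {..<s} \<rho>" for \<rho>
        proof -
          have "\<not> [head \<rho> 0 l = z] (mod m)" using that(2) True b(2) zZ(1) s0 unfolding valid_def by auto
          then show ?thesis using diff[OF that(1)] 1 zZ by (simp add: head_def)
        qed
        then show ?thesis by blast
      next
        case False
        have "l \<le> 2 * K" using b(3) 1 zZ plow[of 0] s0 by simp
        then have ?long
          using False 1 zZ s0 card_ge[of 0] by (intro long[of 0 l 0]) (auto simp: part_def layer_def min_def)
        then show ?thesis ..
      qed
    qed
  next
    case 2
    show ?thesis
    \<comment> \<open>If one of the two pieces contributes more than \<open>K\<close> elements, its
      block varies the sum; otherwise the interval lies within \<open>K\<close> elements of the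
      junction and \<open>valid\<close> excludes it.\<close>
    proof (cases "K < plen a - k")
      case T: True
      have ?long
      proof (cases "a < s")
        case True
        then show ?thesis
          using T 2 s card_ge[of a] plow[of a] len a(2)
          by (intro long[of a "2 * K - k" k]) (auto simp: part_def layer_def sum_list_take_diff)
      next
        case False
        then obtain c where c: "a = s + c" using le_Suc_ex not_less by blast
        then have cs: "c < s" using a(1) by simp
        show ?thesis
          using T 2 s card_ge[OF cs] phigh[OF cs] len[of _ c] a(2) c cs
          by (intro long[of c "card (D c) - 2 * K - k" "2 * K + k"])
            (auto simp: part_def layer_def sum_list_drop_eq[symmetric] add.commute)
      qed
      then show ?thesis ..
    next
      case F: False
      show ?thesis
      proof (cases "K < l")
        case T: True
        have ?long
        proof (cases "b < s")
          case True
          then show ?thesis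
            using T 2 s card_ge[of b] plow[of b] b(3)
            by (intro long[of b l 0]) (auto simp: part_def layer_def min_def)
        next
          case False
          then obtain c where c: "b = s + c" using le_Suc_ex not_less by blast
          then have cs: "c < s" using b(1) by simp
          have "part a k b l c \<tau> = 0" "part a k b l (s + c) \<tau> = sum_list (take l (drop (2 * K) \<tau>))" for \<tau>
          proof -
            have "c < b" "c < a" "b div s = 1" "\<not> b < a" "b \<noteq> a" using 2 c cs s index_high(1)[OF cs] by simp_all
            then show "part a k b l c \<tau> = 0" "part a k b l (s + c) \<tau> = sum_list (take l (drop (2 * K) \<tau>))"
              unfolding c[symmetric] by (simp_all add: part_def layer_def)
          qed
          then show ?thesis
            using T card_ge[OF cs] phigh[OF cs] b(3) c cs by (intro long[of c l "2 * K"]) auto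
        qed
        then show ?thesis ..
      next
        case lK: False
        define r where "r = plen a - k"
        have r: "0 < r" "r \<le> K" "r \<le> plen a" "plen a - r = k" using F a(2) by (auto simp: r_def)
        have "k > 0" using r plen_ge[of a] K by linarith
        then have z0: "z = 0" using z by simp
        have "\<not> [psum \<rho> (off b + l) - psum \<rho> (off a + k) = z] (mod m)" if "\<rho> \<in> orders" "valid {..<s} \<rho>" for \<rho>
        proof -
          have "prv b = a" "target b = 0" using 2 by (simp_all add: prv_def target_def)
          moreover have "prv b mod s \<in> {..<s}" "b mod s \<in> {..<s}" using s0 by simp_all
          ultimately have "\<not> [tail \<rho> a r + head \<rho> b l = 0] (mod m)"
            using that(2) b(1) r lK unfolding valid_def by (metis not_less)
          moreover have "psum \<rho> (off b + l) - psum \<rho> (off a + k) = tail \<rho> a r + head \<rho> b l"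
            using diff[OF that(1)] tail_eq[OF that(1) r(3)] r(4) 2 by simp
          ultimately show ?thesis using z0 by simp
        qed
        then show ?thesis by blast
      qed
    qed
  next
    case 3
    \<comment> \<open>A piece strictly inside the interval whose partner layer is outside. If
      \<open>b - a < s\<close>, the piece after \<open>a\<close> will do; otherwise the partner is
      taken just before \<open>a\<close>, or just after \<open>b\<close> when \<open>a = 0\<close>.
      From piece 0 to piece \<open>2 * s - 1\<close> there is none.\<close>
    have "\<exists>g. a < g \<and> g < b \<and> (g < s \<longrightarrow> b < s + g) \<and> (s \<le> g \<longrightarrow> g - s < a)"
    proof -
      consider "b - a < s" | "s \<le> b - a" "a > 0" | "s \<le> b - a" "a = 0" by linarith
      then show ?thesis
      proof cases
        case c1: 1
        then show ?thesis using 3 s by (intro exI[of _ "a + 1"]) auto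
      next
        case c2: 2
        then show ?thesis using 3 s by (intro exI[of _ "a - 1 + s"]) auto
      next
        case c3: 3
        then show ?thesis using 3 s b(1) by (intro exI[of _ "b + 1 - s"]) auto
      qed
    qed
    then obtain g where g: "a < g" "g < b" "g < s \<longrightarrow> b < s + g" "s \<le> g \<longrightarrow> g - s < a" by blast
    have ?long
    proof (cases "g < s")
      case True
      then show ?thesis
        using g s card_ge[of g] by (intro long[of g "2 * K" 0]) (auto simp: part_def layer_def)
    next
      case False
      then obtain c where c: "g = s + c" using le_Suc_ex not_less by blast
      then have cs: "c < s" using g(2) b(1) by simp
      show ?thesis
        using g c s cs card_ge[OF cs] len[of _ c] by (intro long[of c "card (D c) - 2 * K" "2 * K"]) (auto simp: part_def layer_def)
    qed
    then show ?thesis ..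
  next
    case 4
    have k2: "k < 2 * K" using a(2) 4(1) plow[of 0] s0 by simp
    have bs: "b = s + (s - 1)" using 4(2) s by simp
    have pb: "plen b = card (D (s - 1)) - 2 * K" unfolding bs using s0 by (intro phigh) simp
    define r where "r = plen b - l"
    have r: "r \<le> plen b" "plen b - r = l" "r < plen b" using b(2,3) by (auto simp: r_def)
    show ?thesis
    \<comment> \<open>The interval runs from the first piece to the last. If it misses at least
      \<open>K\<close> elements at the front or at the back, block 0 or block \<open>s - 1\<close>
      varies the sum. Otherwise \<open>valid\<close> governs the missing elements, and
      \<open>total_nonzero\<close> and \<open>total_Z\<close> the case that none is missing.\<close>
    proof (cases "K \<le> k")
      case True
      have p0: "part a k b l 0 \<tau> = sum_list (take (2 * K) \<tau>) - sum_list (take k \<tau>)"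
        and p1: "part a k b l (s + 0) \<tau> = sum_list (drop (2 * K) \<tau>)" for \<tau>
      proof -
        have "0 < b" "s < b" "\<not> s < a" "s \<noteq> a" "s div s = 1" using bs s 4(1) by simp_all
        then show "part a k b l 0 \<tau> = sum_list (take (2 * K) \<tau>) - sum_list (take k \<tau>)"
          "part a k b l (s + 0) \<tau> = sum_list (drop (2 * K) \<tau>)"
          using 4(1) k2 by (simp_all add: part_def layer_def)
      qed
      have ?long
      proof (rule long[of 0 "card (D 0) - k" k])
        fix \<tau> assume "\<tau> \<in> permutations_of_set (D 0)"
        then show "part a k b l 0 \<tau> + part a k b l (s + 0) \<tau> = sum_list (take (card (D 0) - k) (drop k \<tau>))"
          unfolding p0 p1 using len[of \<tau> 0] by (simp add: sum_list_drop_eq)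
      qed (use True k2 s0 card_ge[of 0] in auto)
      then show ?thesis ..
    next
      case kK: False
      show ?thesis
      proof (cases "K \<le> r")
        case True
        have p0: "part a k b l (s - 1) \<tau> = sum_list (take (2 * K) \<tau>)"
          and p1: "part a k b l (s + (s - 1)) \<tau> = sum_list (take l (drop (2 * K) \<tau>))" for \<tau>
        proof -
          have "s - 1 < b" "s - 1 \<noteq> a" "b \<noteq> a" "(s - 1) div s = 0" "b div s = 1"
            using bs s 4(1) index_low(1)[of "s - 1"] index_high(1)[of "s - 1"] by simp_all
          then show "part a k b l (s - 1) \<tau> = sum_list (take (2 * K) \<tau>)"
            "part a k b l (s + (s - 1)) \<tau> = sum_list (take l (drop (2 * K) \<tau>))"
            unfolding bs[symmetric] using 4(1) by (simp_all add: part_def layer_def)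
        qed
        have ?long
        proof (rule long[of "s - 1" "2 * K + l" 0])
          fix \<tau> :: "int list"
          show "part a k b l (s - 1) \<tau> + part a k b l (s + (s - 1)) \<tau> = sum_list (take (2 * K + l) (drop 0 \<tau>))"
            unfolding p0 p1 by (simp add: take_add)
        qed (use True s0 card_ge[of "s - 1"] pb r(2) b(3) in auto)
        then show ?thesis ..
      next
        case rK: False
        have "\<not> [psum \<rho> (off b + l) - psum \<rho> (off a + k) = z] (mod m)" if \<rho>: "\<rho> \<in> orders" "valid {..<s} \<rho>" for \<rho>
        proof -
          have "T0 = (\<Sum>d<b. sum_list (piece \<rho> d)) + sum_list (piece \<rho> b)"
          proof -
            have "2 * s = Suc b" using 4 s by simp
            then show ?thesis using sum_pieces[OF \<rho>(1)] by simp
          qed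
          then have e: "psum \<rho> (off b + l) - psum \<rho> (off a + k) = T0 - tail \<rho> b r - head \<rho> 0 k"
            using diff[OF \<rho>(1)] tail_eq[OF \<rho>(1) r(1)] r(2) 4(1) by simp
          have act: "prv 0 = b" "target 0 = T0" "b mod s \<in> {..<s}" "0 mod s \<in> {..<s}" "(0::nat) < 2 * s" "s - 1 \<in> {..<s}"
            using 4 s by (simp_all add: prv_def target_def)
          show ?thesis
          proof (cases "z = 0")
            case True
            show ?thesis
            proof (cases "k = 0 \<and> r = 0")
              case True
              then show ?thesis using e \<open>z = 0\<close> total_nonzero by (simp add: tail_def head_def cong_0_iff T0_def)
            next
              case False
              then have "\<not> [tail \<rho> b r + head \<rho> 0 k = T0] (mod m)"
                using \<rho>(2) act kK rK unfolding valid_def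
                by (metis gr0I nat_le_linear)
              then show ?thesis using e \<open>z = 0\<close> by (auto simp: cong_iff_dvd_diff dvd_diff_commute algebra_simps)
            qed
          next
            case False
            then have zZ: "z \<in> Z" "k = 0" using z by auto
            have e': "psum \<rho> (off b + l) - psum \<rho> (off a + k) = T0 - tail \<rho> b r" using e zZ by (simp add: head_def)
            show ?thesis
            proof (cases "r = 0")
              case True
              then show ?thesis using e' total_Z[OF zZ(1)] by (simp add: tail_def T0_def)
            next
              case False
              then have "\<not> [T0 - tail \<rho> b r = z] (mod m)"
                using \<rho>(2) act(6) zZ(1) rK 4(2) unfolding valid_def by auto
              then show ?thesis using e' by simp
            qed
          qed
        qed
        then show ?thesis by blast
      qed
    qed
  qed
qed

section \<open>Comparing probabilities and existence of a good word\<close>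

lemma binomial_ge_end:
  fixes L n :: nat
  assumes "K \<le> n" "n + K \<le> L"
  shows "L choose K \<le> L choose n"
proof (cases "2 * n \<le> L")
  case True
  then show ?thesis using assms(1) by (intro binomial_mono) auto
next
  case False
  have "L choose K \<le> L choose (L - n)" using assms False by (intro binomial_mono) auto
  also have "\<dots> = L choose n" using assms binomial_symmetric[of n L] by simp
  finally show ?thesis .
qed

text \<open>Binomial coefficients in the middle range are at least the one at \<open>K\<close>,
  which is at least \<open>(card (D c) / K) ^ K\<close>; the block size \<open>2 ^ 20 * K\<close>
  turns this into \<open>2 ^ (20 * K)\<close>.\<close>

lemma fact_middle_bound:
  assumes c: "c < s" and n: "K \<le> n" "n + K \<le> card (D c)"
  shows "fact n * fact (card (D c) - n) * (2::real) ^ (20 * K) \<le> fact (card (D c))"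
proof -
  let ?L = "card (D c)"
  have L: "2 ^ 20 * K \<le> ?L" using large[OF c] .
  have "(2::real) ^ 20 \<le> real ?L / real K" using L K by (simp add: field_simps)
  then have "((2::real) ^ 20) ^ K \<le> (real ?L / real K) ^ K" by (intro power_mono) auto
  also have "\<dots> \<le> real (?L choose K)" using card_ge[OF c] by (intro binomial_ge_n_over_k_pow_k) simp
  also have "\<dots> \<le> real (?L choose n)" using binomial_ge_end[OF n] by simp
  finally have "(2::real) ^ (20 * K) \<le> real (?L choose n)" by (simp add: power_mult)
  then have "fact n * fact (?L - n) * (2::real) ^ (20 * K) \<le> fact n * fact (?L - n) * real (?L choose n)"
    by (intro mult_left_mono) auto
  also have "\<dots> = fact ?L" using binomial_fact_lemma[of n ?L] n by (metis add_leD1 of_nat_fact of_nat_mult)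
  finally show ?thesis .
qed

text \<open>Each of the \<open>4 * K\<close> controlled positions costs a factor of at most 16,
  since at least \<open>q\<close> of at most \<open>16 * q\<close> elements are admissible.\<close>

lemma card_good_lists_ge:
  assumes i: "i < s"
  shows "fact (card (D i)) \<le> card (good_lists \<rho> i) * (2::real) ^ (16 * K)"
proof -
  let ?L = "card (D i)"
  have "fact ?L \<le> ?L ^ (4 * K) * fact (?L - 4 * K)"
    using fact_div_fact_le_pow[of "4 * K" ?L] card_ge[OF i]
    by (metis div_le_mono dvd_div_mult_self fact_dvd diff_le_self less_imp_le mult_le_mono1)
  also have "?L ^ (4 * K) \<le> (16 * q) ^ (4 * K)" using q16[OF i] by (intro power_mono) auto
  also have "(16 * q) ^ (4 * K) * fact (?L - 4 * K) = 16 ^ (4 * K) * (q ^ (4 * K) * fact (?L - 4 * K))"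
    by (simp add: power_mult_distrib)
  also have "\<dots> \<le> 16 ^ (4 * K) * card (good_lists \<rho> i)" using card_good_lists[OF i] by (intro mult_left_mono) auto
  finally have "fact ?L \<le> 16 ^ (4 * K) * card (good_lists \<rho> i)" by simp
  then have "real (fact ?L) \<le> real (16 ^ (4 * K) * card (good_lists \<rho> i))" by (simp only: of_nat_le_iff)
  also have "\<dots> = card (good_lists \<rho> i) * (2::real) ^ (16 * K)"
  proof -
    have "(2::real) ^ (16 * K) = 2 ^ (4 * (4 * K))" by simp
    also have "\<dots> = (2 ^ 4) ^ (4 * K)" by (rule power_mult)
    finally show ?thesis by simp
  qed
  finally show ?thesis by simp
qed

lemma good_word_exists:
  "\<exists>w. distinct w \<and> set w = (\<Union>i<s. D i) \<and>
    (\<forall>i j. i < j \<longrightarrow> j \<le> length w \<longrightarrow> \<not> [sum_list (take j w) - sum_list (take i w) = 0] (mod m)) \<and>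
    (\<forall>j. 0 < j \<longrightarrow> j \<le> length w \<longrightarrow> (\<forall>z\<in>Z. \<not> [sum_list (take j w) = z] (mod m)))"
proof -
  define N where "N = (\<Sum>i<s. card (D i))"
  define Ev where "Ev = {(i, j, z). i < j \<and> j \<le> N \<and> (z = 0 \<or> z \<in> Z \<and> i = 0)}"
  define P where "P = (\<lambda>(i, j, z) \<rho>. [psum \<rho> j - psum \<rho> i = z] (mod m))"
  define \<Omega> where "\<Omega> = {\<rho> \<in> orders. valid {..<s} \<rho>}"
  \<comment> \<open>\<open>\<theta>\<close> bounds the share of good lists from below,
    \<open>\<eta>\<close> the probability of a middling infix sum from above. As
    \<open>2 ^ (4 * K) * \<eta> = \<theta>\<close>, having fewer than \<open>16 ^ K\<close> events
    suffices.\<close>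
  define \<theta> where "\<theta> = 1 / (2::real) ^ (16 * K)"
  define \<eta> where "\<eta> = 1 / (2::real) ^ (20 * K)"
  have cardX: "card (permutations_of_set (D i)) = fact (card (D i))" if "i < s" for i
    using finD[OF that] by (rule card_permutations_of_set)
  have subEv: "Ev \<subseteq> {..<N} \<times> {1..N} \<times> insert 0 Z" by (auto simp: Ev_def)
  have "\<exists>\<rho>\<in>\<Omega>. \<forall>e\<in>Ev. \<not> P e \<rho>"
  proof (rule card_perms_avoid[where I = "{..<s}" and X = "\<lambda>i. permutations_of_set (D i)" and \<theta> = \<theta> and \<eta> = \<eta>])
    show "\<Omega> \<subseteq> PiE {..<s} (\<lambda>i. permutations_of_set (D i))" by (auto simp: \<Omega>_def orders_def)
    show "\<Omega> \<noteq> {}" using valid_orders_nonempty by (auto simp: \<Omega>_def)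
    show "finite Ev" using subEv by (rule finite_subset) (use finZ in simp)
    show "\<theta> * real (card (permutations_of_set (D i))) \<le> real (card {\<sigma> \<in> permutations_of_set (D i). \<rho>(i := \<sigma>) \<in> \<Omega>})"
      if "\<rho> \<in> \<Omega>" "i \<in> {..<s}" for \<rho> i
    proof -
      have i: "i < s" using that by simp
      have "\<rho>(i := \<tau>) \<in> \<Omega>" if "\<tau> \<in> good_lists \<rho> i" for \<tau>
      proof -
        have "valid (insert i {..<s}) (\<rho>(i := \<tau>))" using \<open>\<rho> \<in> \<Omega>\<close> that by (intro valid_upd) (auto simp: \<Omega>_def)
        then show ?thesis using i that \<open>\<rho> \<in> \<Omega>\<close>
          by (auto simp: \<Omega>_def orders_def good_lists_def PiE_iff extensional_def insert_absorb)
      qed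
      then have "card (good_lists \<rho> i) \<le> card {\<sigma> \<in> permutations_of_set (D i). \<rho>(i := \<sigma>) \<in> \<Omega>}"
        by (intro card_mono) (auto simp: good_lists_def)
      moreover have "\<theta> * fact (card (D i)) \<le> card (good_lists \<rho> i)"
        using card_good_lists_ge[OF i, of \<rho>] by (simp add: \<theta>_def field_simps)
      ultimately show ?thesis by (simp add: cardX[OF i])
    qed
    show "real (card Ev) * \<eta> < \<theta>"
    proof -
      have "card Ev \<le> card ({..<N} \<times> {1..N} \<times> insert 0 Z)" using subEv finZ by (intro card_mono) auto
      also have "\<dots> = N * (N * card (insert 0 Z))" by (simp add: card_cartesian_product)
      also have "\<dots> \<le> N * (N * (card Z + 1))" using card_insert_le_m1[of "card Z + 1" Z 0] by (simp add: card_insert_if finZ)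
      also have "\<dots> < 16 ^ K" using few by (simp add: N_def power2_eq_square algebra_simps)
      finally have "real (card Ev) < 2 ^ (4 * K)" by (simp add: power_mult)
      then have "real (card Ev) * \<eta> < 2 ^ (4 * K) * \<eta>" by (simp add: \<eta>_def divide_strict_right_mono)
      also have "\<dots> = \<theta>" by (simp add: \<eta>_def \<theta>_def field_simps flip: power_add)
      finally show ?thesis .
    qed
    fix e assume "e \<in> Ev"
    then obtain i j z where e: "e = (i, j, z)" "i < j" "j \<le> N" "z = 0 \<or> z \<in> Z \<and> i = 0" by (auto simp: Ev_def)
    have offN: "off (2 * s) = N" unfolding N_def by (rule off_total)
    obtain a k where a: "a < 2 * s" "k < plen a" "i = off a + k" using locate_start[of i "2 * s"] e offN by auto
    obtain b l where b: "b < 2 * s" "0 < l" "l \<le> plen b" "j = off b + l" using locate_end[of j "2 * s"] e offN by auto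
    have za: "z = 0 \<or> z \<in> Z \<and> a = 0 \<and> k = 0"
    proof -
      have "a = 0" if "i = 0"
      proof (rule ccontr)
        assume "a \<noteq> 0"
        then have "off 1 \<le> off a" by (intro off_mono) simp
        then show False using that a(3) plen_ge[of 0] K by (simp add: off_def)
      qed
      then show ?thesis using e(4) a(3) by auto
    qed
    from interval_dichotomy[OF a(1,2) b(1-3) _ za] e(2) a(3) b(4)
    consider "\<forall>\<rho>\<in>orders. valid {..<s} \<rho> \<longrightarrow> \<not> [psum \<rho> j - psum \<rho> i = z] (mod m)"
      | c n where "c < s" "K \<le> n" "n + K \<le> card (D c)" "\<forall>\<rho>\<in>orders.
          card {\<tau> \<in> permutations_of_set (D c). [psum (\<rho>(c := \<tau>)) j - psum (\<rho>(c := \<tau>)) i = z] (mod m)}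
        \<le> fact n * fact (card (D c) - n)"
      by blast
    then show "(\<forall>\<rho>\<in>\<Omega>. \<not> P e \<rho>) \<or> (\<exists>i\<in>{..<s}. \<forall>\<rho>\<in>\<Omega>.
      real (card {\<sigma> \<in> permutations_of_set (D i). P e (\<rho>(i := \<sigma>))}) \<le> \<eta> * real (card (permutations_of_set (D i))))"
    proof cases
      case 1
      then show ?thesis by (auto simp: \<Omega>_def P_def e(1))
    next
      case (2 c n)
      have "real (card {\<sigma> \<in> permutations_of_set (D c). P e (\<rho>(c := \<sigma>))}) \<le> \<eta> * real (card (permutations_of_set (D c)))"
        if "\<rho> \<in> \<Omega>" for \<rho>
      proof -
        have "card {\<sigma> \<in> permutations_of_set (D c). P e (\<rho>(c := \<sigma>))} \<le> fact n * fact (card (D c) - n)"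
          using 2(4) that by (simp add: P_def e(1) \<Omega>_def)
        then have "real (card {\<sigma> \<in> permutations_of_set (D c). P e (\<rho>(c := \<sigma>))}) \<le> real (fact n * fact (card (D c) - n))"
          by (simp only: of_nat_le_iff)
        also have "\<dots> \<le> \<eta> * fact (card (D c))"
          using fact_middle_bound[OF 2(1-3)] by (simp add: \<eta>_def field_simps)
        finally show ?thesis using cardX[OF 2(1)] by simp
      qed
      then show ?thesis using 2(1) by blast
    qed
  qed (auto simp: \<theta>_def \<eta>_def)
  then obtain \<rho> where \<rho>': "\<rho> \<in> \<Omega>" "\<forall>e\<in>Ev. \<not> P e \<rho>" by blast
  then have \<rho>: "\<rho> \<in> orders" "\<And>i j z. (i, j, z) \<in> Ev \<Longrightarrow> \<not> [psum \<rho> j - psum \<rho> i = z] (mod m)"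
    by (auto simp: \<Omega>_def P_def)
  have lw: "length (word \<rho>) = N" using length_word[OF \<rho>(1)] by (simp add: N_def)
  have "\<not> [sum_list (take j (word \<rho>)) - sum_list (take i (word \<rho>)) = 0] (mod m)" if "i < j" "j \<le> length (word \<rho>)" for i j
    using \<rho>(2)[of i j 0] that lw by (simp add: Ev_def psum_def)
  moreover have "\<not> [sum_list (take j (word \<rho>)) = z] (mod m)" if "0 < j" "j \<le> length (word \<rho>)" "z \<in> Z" for j z
    using \<rho>(2)[of 0 j z] that lw by (simp add: Ev_def psum_def)
  ultimately show ?thesis
    using set_word[OF \<rho>(1)] distinct_word[OF \<rho>(1)] by blast
qed

end

section \<open>Assembling the ordering\<close>

text \<open>The condition \<open>0 < i\<close> reflects that the empty sum is not compared:
  intervals containing the first element are exempt.\<close>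

definition separating_order :: "int \<Rightarrow> int set \<Rightarrow> int list \<Rightarrow> bool" where
  "separating_order m A xs \<longleftrightarrow> distinct xs \<and> set xs = A \<and>
    (\<forall>i j. 0 < i \<longrightarrow> i < j \<longrightarrow> j \<le> length xs \<longrightarrow> \<not> m dvd sum_list (take j xs) - sum_list (take i xs))"

lemma proper_infixesD:
  assumes "proper_infixes_nonzero m xs" "i < j" "j \<le> length xs" "0 < i \<or> j < length xs"
  shows "\<not> m dvd sum_list (take j xs) - sum_list (take i xs)"
proof -
  have "xs = take i xs @ take (j - i) (drop i xs) @ drop j xs"
    using assms(2) by (metis append_take_drop_id drop_drop le_add_diff_inverse2 less_imp_le)
  moreover have "take (j - i) (drop i xs) \<noteq> []" "take i xs @ drop j xs \<noteq> []" using assms(2-4) by auto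
  ultimately have "\<not> m dvd sum_list (take (j - i) (drop i xs))"
    using assms(1) unfolding proper_infixes_nonzero_def by blast
  then show ?thesis using sum_list_take_diff[of i j xs] assms(2) by simp
qed

lemma rectifiable_separating_order:
  fixes A B :: "int set" and p :: nat
  assumes "prime p" "A \<subseteq> {1..<int p}" "A \<subseteq> box p B M" "finite B" "M \<ge> 0"
    "card B \<le> d" "Q > int (card A) * int d * M" "Q ^ d < int p"
  shows "\<exists>xs. distinct xs \<and> set xs = A \<and> proper_infixes_nonzero p xs"
proof (rule rectifiable_order[OF assms(1-5)])
  have "int (card A) * int (card B) * M \<le> int (card A) * int d * M"
    using assms(5,6) by (intro mult_right_mono mult_left_mono) auto
  then show "Q > int (card A) * int (card B) * M" using assms(7) by linarith
  have "Q \<ge> 1" using assms(5,7) by (smt (verit) of_nat_0_le_iff mult_nonneg_nonneg)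
  then have "Q ^ card B \<le> Q ^ d" using assms(6) by (intro power_increasing) auto
  then show "Q ^ card B < int p" using assms(8) by linarith
qed

text \<open>The bounds on \<open>Q\<close> are those of rectification in a box with
  \<open>2 ^ 22 * K\<close> generators and coefficients up to \<open>(K + 1) * (card A + 1)\<close>,
  the bound that shielding produces.\<close>

lemma separating_order_exists:
  fixes A :: "int set" and p K :: nat
  assumes p: "prime p" and A: "A \<subseteq> {1..<int p}" and K: "K > 0" "card A + 2 \<le> 2 ^ K"
    and Q: "Q > int (card A) * int (2 ^ 22 * K) * ((int K + 1) * (int (card A) + 1))" "Q ^ (2 ^ 22 * K) < int p"
  shows "\<exists>xs. separating_order p A xs"
proof -
  define n where "n = card A"
  define N where "N = int n"
  \<comment> \<open>\<open>R = 16 * q = 2 ^ 21 * K\<close> leaves more than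
    \<open>2 ^ 20 * K\<close> elements in a block after the loss of three, and half of a cluster of
    half a block, about \<open>4 * q\<close> elements, still exceeds
    \<open>q + 5 * K + 1\<close>.\<close>
  define q where "q = 2 ^ 17 * K"
  define R where "R = 16 * q"
  define M0 where "M0 = (int K + 1) * (N + 1)"
  have R: "R = 2 ^ 21 * K" "2 * R = 2 ^ 22 * K" by (simp_all add: R_def q_def)
  have R100: "R > 100" using K(1) R(1) by simp
  have finA: "finite A" using A finite_subset by blast
  have M0: "M0 \<ge> 1" "M0 \<ge> 0" using mult_mono[of 1 "int K + 1" 1 "N + 1"] by (simp_all add: M0_def N_def)
  have p0: "int p > 0" using p prime_gt_0_nat by simp
  have distinct_mod: "a = b" if "a \<in> A" "b \<in> A" "[a = b] (mod int p)" for a b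
    using that A by (metis atLeastLessThan_iff cong_less_imp_eq_int subsetD zero_le_one order_trans)
  show ?thesis
  \<comment> \<open>The factor 2 in \<open>2 * R\<close> leaves room for \<open>B\<close> together
    with one whole block, and for the few generators that shielding adds.\<close>
  proof (cases "\<exists>B. finite B \<and> card B \<le> 2 * R \<and> A \<subseteq> box p B M0")
    case True
    then obtain B where B: "finite B" "card B \<le> 2 * R" "A \<subseteq> box p B M0" by blast
    obtain xs where "distinct xs" "set xs = A" "proper_infixes_nonzero p xs"
      using rectifiable_separating_order[OF p A B(3,1) M0(2) B(2)] Q unfolding R(2) M0_def N_def n_def by blast
    then show ?thesis using proper_infixesD unfolding separating_order_def by blast
  next
    case False
    have nonrect: "\<not> A \<subseteq> box p B M0" if "finite B" "card B \<le> 2 * R" for B using False that by blast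
    have "\<exists>(s::nat) D B. (\<forall>i<s. D i \<subseteq> A \<and> card (D i) = R \<and> dissociated p (D i)) \<and>
      (\<forall>i<s. \<forall>j<s. i \<noteq> j \<longrightarrow> D i \<inter> D j = {}) \<and>
      B \<subseteq> A - (\<Union>i<s. D i) \<and> card B < R \<and> A - (\<Union>i<s. D i) \<subseteq> box p B 1"
      using R100 by (intro dissociated_decomposition finA) simp
    then obtain s :: nat and D B where D: "\<forall>i<s. D i \<subseteq> A \<and> card (D i) = R \<and> dissociated p (D i)"
      "\<forall>i<s. \<forall>j<s. i \<noteq> j \<longrightarrow> D i \<inter> D j = {}"
      and B: "B \<subseteq> A - (\<Union>i<s. D i)" "card B < R" "A - (\<Union>i<s. D i) \<subseteq> box p B 1"
      by (elim exE conjE) (rule that)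
    define E where "E = A - (\<Union>i<s. D i)"
    have finB: "finite B" using B(1) finA by (auto intro: finite_subset)
    have finD: "finite (D i)" if "i < s" for i using D(1) that finA finite_subset by blast
    have s: "s \<ge> 2"
    proof (rule ccontr)
      assume "\<not> s \<ge> 2"
      then consider "s = 0" | "s = 1" by linarith
      then show False
      proof cases
        case 1
        then have "A \<subseteq> box p B 1" using B(3) by simp
        also have "\<dots> \<subseteq> box p B M0" using M0 finB by (intro box_mono) auto
        finally show False using nonrect[of B] finB B(2) by simp
      next
        case 2
        then have f0: "finite (D 0)" "card (D 0) = R" using finD D(1) by auto
        have "A \<subseteq> E \<union> D 0" using 2 by (auto simp: E_def)
        moreover have "E \<subseteq> box p (B \<union> D 0) M0"
          using B(3) box_mono[of "B \<union> D 0" B 1 M0 p] M0 finB f0 by (auto simp: E_def)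
        moreover have "D 0 \<subseteq> box p (B \<union> D 0) M0"
          using finB f0 M0 by (auto intro: box_base)
        moreover have "card (B \<union> D 0) \<le> 2 * R" using card_Un_le[of B "D 0"] f0 B(2) by simp
        ultimately show False using nonrect[of "B \<union> D 0"] finB f0 by blast
      qed
    qed
    have D0: "finite (D 0)" "card (D 0) = R" "D 0 \<subseteq> A" using s D(1) finD by auto
    \<comment> \<open>Rectification may leave the full sum of \<open>E\<close> zero. Moving an
      element \<open>u\<close> of a block into \<open>E\<close> prevents this: two different
      candidates cannot both give zero.\<close>
    obtain u where u: "u \<in> D 0" "\<not> int p dvd \<Sum>E + u"
    proof -
      have "D 0 \<noteq> {}" using D0 R100 by auto
      then obtain u1 where u1: "u1 \<in> D 0" by blast
      have "D 0 \<noteq> {u1}" using D0(2) R100 by auto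
      then obtain u2 where u2: "u2 \<in> D 0" "u2 \<noteq> u1" using u1 by blast
      have "\<not> int p dvd \<Sum>E + u1 \<or> \<not> int p dvd \<Sum>E + u2"
      proof (rule ccontr)
        assume "\<not> ?thesis"
        then have "int p dvd (\<Sum>E + u1) - (\<Sum>E + u2)" using dvd_diff by blast
        then have "[u1 = u2] (mod int p)" by (simp add: cong_iff_dvd_diff)
        then show False using distinct_mod u1 u2 D0(3) by blast
      qed
      then show ?thesis using that u1 u2 by blast
    qed
    define E1 where "E1 = insert u E"
    define B1 where "B1 = insert u B"
    define U1 where "U1 = (\<Union>i<s. D i) - {u}"
    define D1 where "D1 = (\<lambda>i. D i - {u})"
    define t where "t = \<Sum>U1"
    have finB1: "finite B1" "card B1 \<le> R" using finB B(2) card_insert_le_m1[of R B u] by (auto simp: B1_def card_insert_if)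
    have AEU: "A = E1 \<union> U1" "E1 \<inter> U1 = {}"
    proof -
      have "(\<Union>i<s. D i) \<subseteq> A" using D(1) by blast
      moreover have "u \<in> (\<Union>i<s. D i)" using u(1) s by force
      ultimately show "A = E1 \<union> U1" "E1 \<inter> U1 = {}" by (auto simp: E1_def U1_def E_def)
    qed
    have finE1: "finite E1" "finite U1" "card E1 \<le> n"
      using AEU(1) finA card_mono[of A E1] by (auto simp: n_def)
    have E1box: "E1 \<subseteq> box p B1 1"
      using B(3) box_mono[of B1 B 1 1 p] box_base[of B1 u 1 p] finB1 by (auto simp: E1_def B1_def E_def)
    have uE: "u \<notin> E" using u(1) s by (auto simp: E_def)
    have E1sum: "\<not> int p dvd \<Sum>E1"
      using u(2) uE finA by (simp add: E1_def E_def add.commute)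
    obtain es where es: "distinct es" "set es = E1" "proper_infixes_nonzero p es"
    proof -
      have "Q > int (card E1) * int (2 * R) * 1"
      proof -
        have "int (card E1) * int (2 * R) * 1 \<le> int (card A) * int (2 * R) * M0"
          using finE1(3) M0 by (intro mult_mono) (auto simp: n_def)
        then show ?thesis using Q(1) unfolding R(2) M0_def N_def n_def by linarith
      qed
      then show ?thesis
        using rectifiable_separating_order[OF p _ E1box finB1(1) _ _ _ Q(2)[folded R(2)]] AEU(1) A finB1(2) that by auto
    qed
    have es_diff: "\<not> int p dvd sum_list (take j es) - sum_list (take i es)" if "i < j" "j \<le> length es" for i j
    proof (cases "i = 0 \<and> j = length es")
      case True
      then show ?thesis using E1sum es(1,2) distinct_sum_list_conv_Sum[OF es(1)] by simp
    next
      case False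
      then show ?thesis using proper_infixesD[OF es(3) that] that by auto
    qed
    \<comment> \<open>The sums of all suffixes of \<open>es\<close>, the empty one included at
      \<open>i = length es\<close>: every interval that ends beyond \<open>es\<close> and starts no
      later than its end begins with such a suffix.\<close>
    define F where "F = (\<lambda>i. sum_list (drop i es)) ` {..length es}"
    have finF: "finite F" "card F \<le> n + 1"
    proof -
      show "finite F" by (simp add: F_def)
      have "card F \<le> card {..length es}" unfolding F_def by (rule card_image_le) simp
      also have "\<dots> \<le> n + 1" using finE1(3) es(1,2) distinct_card[OF es(1)] by simp
      finally show "card F \<le> n + 1" .
    qed
    have Fbox: "f \<in> box p B1 N" if fF: "f \<in> F" for f
    proof -
      obtain i where i: "f = sum_list (drop i es)" using fF by (auto simp: F_def)
      have sub: "set (drop i es) \<subseteq> E1" using set_drop_subset[of i es] es(2) by simp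
      have "f = \<Sum>(set (drop i es))" using i es(1) by (simp add: distinct_sum_list_conv_Sum)
      also have "\<dots> \<in> box p B1 (int (card (set (drop i es))) * 1)"
        using E1box sub by (intro box_sum) auto
      also have "card (set (drop i es)) \<le> n"
        using card_mono[OF finE1(1) sub] finE1(3) by linarith
      then have "box p B1 (int (card (set (drop i es))) * 1) \<subseteq> box p B1 N"
        using finB1 by (intro box_mono) (auto simp: N_def)
      finally show ?thesis .
    qed
    have notbox: "\<not> U1 \<subseteq> box p B' M0" if "B1 \<subseteq> B'" "finite B'" "card B' \<le> 2 * R" for B'
    proof
      assume "U1 \<subseteq> box p B' M0"
      moreover have "E1 \<subseteq> box p B' M0" using E1box box_mono[of B' B1 1 M0 p] that M0 by auto
      ultimately show False using nonrect[of B'] that AEU(1) by blast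
    qed
    have card_ins: "card (insert v S) \<le> card S + 1" for v :: int and S
      by (metis Suc_eq_plus1 card_insert_le_m1 diff_add_inverse2 le_refl add_gr_0 zero_less_one)
    have finD1: "finite (D1 i)" "R \<le> card (D1 i) + 1" if "i < s" for i
      using finD[OF that] D(1) that diff_card_le_card_Diff[of "{u}" "D i"] by (auto simp: D1_def)
    have X1: "\<not> U1 \<subseteq> box p (insert 0 (insert c B1)) ((int K + 1) * (N + 1))" for c
      using notbox[of "insert 0 (insert c B1)"] finB1 card_ins[of 0 "insert c B1"] card_ins[of c B1] R100
      unfolding M0_def by auto
    \<comment> \<open>The front of \<open>w\<close>: with shift 0, \<open>b\<close> itself avoids
      the box that holds \<open>F\<close>, and after few elements of \<open>C0\<close> at most half
      of the continuations in \<open>C0\<close> enter it.\<close>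
    obtain b C0 where b: "b \<in> U1" and C0: "C0 \<subseteq> D1 0" "card (D1 0) \<le> 2 * card C0" and b0: "0 + b \<notin> box p B1 N"
      and C0': "\<And>S. S \<subseteq> C0 \<Longrightarrow> int (card S) < int K \<Longrightarrow> 2 * card {y \<in> C0. 0 + b + \<Sum>S + y \<in> box p B1 N} \<le> card C0"
      using shielded_cluster[OF finB1(1) finD1(1)[of 0] _ _ X1] s by (auto simp: N_def)
    \<comment> \<open>Excluding \<open>t - b\<close> keeps the total \<open>t - b - x\<close> of
      \<open>w\<close> nonzero modulo \<open>p\<close>.\<close>
    define X where "X = {a \<in> U1. a \<noteq> b \<and> \<not> [a = t - b] (mod int p)}"
    have X2: "\<not> X \<subseteq> box p (insert (- t) (insert c B1)) ((int K + 1) * (N + 1))" for c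
    proof
      assume X: "X \<subseteq> box p (insert (- t) (insert c B1)) ((int K + 1) * (N + 1))"
      define B' where "B' = insert b (insert (t - b) (insert (- t) (insert c B1)))"
      have B': "finite B'" "B1 \<subseteq> B'" "insert (- t) (insert c B1) \<subseteq> B'" using finB1 by (auto simp: B'_def)
      have "card B' \<le> R + 4"
        using finB1(2) card_ins[of b "insert (t - b) (insert (- t) (insert c B1))"] card_ins[of "t - b" "insert (- t) (insert c B1)"]
          card_ins[of "- t" "insert c B1"] card_ins[of c B1] unfolding B'_def by linarith
      then have cB: "card B' \<le> 2 * R" using R100 by simp
      have "U1 \<subseteq> box p B' M0"
      proof
        fix a assume a: "a \<in> U1"
        have "b \<in> box p B' M0" "t - b \<in> box p B' M0" using B'(1) M0 by (auto intro!: box_base simp: B'_def)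
        moreover have "X \<subseteq> box p B' M0"
          using X box_mono[OF B'(1,3), of M0 M0 p] M0 unfolding M0_def by auto
        ultimately show "a \<in> box p B' M0"
          using a box_cong[of "t - b" p B' M0 a] cong_sym[of a "t - b" "int p"] by (cases "a \<in> X") (auto simp: X_def)
      qed
      then show False using notbox[OF B'(2,1) cB] by blast
    qed
    \<comment> \<open>The back of \<open>w\<close>: a suffix sum \<open>f\<close> of
      \<open>es\<close>, then \<open>b\<close>, then all of \<open>w\<close> but elements of sum
      \<sigma> add up to \<open>f + t - x - \<sigma>\<close>, where \<open>b\<close> has cancelled.
      This vanishes iff \<open>- t + x + \<sigma>\<close> equals \<open>f\<close>, whence the shift
      \<open>- t\<close>.\<close>
    obtain x C1 where x: "x \<in> X" and C1: "C1 \<subseteq> D1 (s - 1)" "card (D1 (s - 1)) \<le> 2 * card C1" and x0: "- t + x \<notin> box p B1 N"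
      and C1': "\<And>S. S \<subseteq> C1 \<Longrightarrow> int (card S) < int K \<Longrightarrow> 2 * card {y \<in> C1. - t + x + \<Sum>S + y \<in> box p B1 N} \<le> card C1"
      using shielded_cluster[OF finB1(1) finD1(1)[of "s - 1"] _ _ X2] s by (auto simp: N_def)
    have xU: "x \<in> U1" "x \<noteq> b" "\<not> [x = t - b] (mod int p)" using x by (auto simp: X_def)
    define D2 where "D2 = (\<lambda>i. D i - {u, b, x})"
    \<comment> \<open>A prefix of \<open>w\<close> with sum \<open>- b - f\<close> would cancel a
      suffix of \<open>es\<close> followed by \<open>b\<close>.\<close>
    define Z where "Z = (\<lambda>f. - b - f) ` F"
    have D2un: "(\<Union>i<s. D2 i) = U1 - {b, x}" by (auto simp: D2_def U1_def)
    have D2dis: "D2 i \<inter> D2 j = {}" if "i < s" "j < s" "i \<noteq> j" for i j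
      using D(2) that by (fastforce simp: D2_def)
    have finD2: "finite (D2 i)" if "i < s" for i using finD[OF that] by (simp add: D2_def)
    have cardD2: "card (D2 i) \<le> R" "R \<le> card (D2 i) + 3" if "i < s" for i
    proof -
      show "card (D2 i) \<le> R" using card_mono[OF finD[OF that], of "D2 i"] D(1) that by (auto simp: D2_def)
      have "card {u, b, x} \<le> 3" by (simp add: card_insert_if)
      then show "R \<le> card (D2 i) + 3"
        using diff_card_le_card_Diff[of "{u, b, x}" "D i"] D(1) that by (auto simp: D2_def)
    qed
    have T0: "(\<Sum>i<s. \<Sum>(D2 i)) = t - b - x"
    proof -
      have "(\<Sum>i<s. \<Sum>(D2 i)) = \<Sum>(\<Union>i<s. D2 i)"
        using finD2 D2dis by (intro sum.UNION_disjoint[symmetric]) auto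
      also have "\<dots> = \<Sum>(U1 - {b} - {x})" unfolding D2un by (simp add: Diff_insert2[symmetric] insert_commute)
      also have "\<dots> = t - b - x" using finE1(2) b xU by (simp add: t_def sum_diff1)
      finally show ?thesis .
    qed
    have sumcard: "(\<Sum>i<s. card (D2 i)) \<le> n"
    proof -
      have "(\<Sum>i<s. card (D2 i)) = card (\<Union>i<s. D2 i)"
        using finD2 D2dis by (intro card_UN_disjoint[symmetric]) auto
      also have "\<dots> \<le> n" unfolding n_def D2un using AEU(1) finA by (intro card_mono) auto
      finally show ?thesis .
    qed
    \<comment> \<open>\<open>C\<close> is at least half of a block and at least half of
      \<open>C\<close> satisfies \<open>P\<close>, which leaves about \<open>4 * q\<close> elements;
      discarding \<open>b\<close> and \<open>x\<close> costs two.\<close>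
    have cluster_room: "q + 5 * K + 1 \<le> card {y \<in> C - {b, x}. P y}"
      if "C \<subseteq> D1 i" "i < s" "card (D1 i) \<le> 2 * card C" "2 * card {y \<in> C. \<not> P y} \<le> card C" for C i P
    proof -
      have finC: "finite C" using that(1) finD1(1)[OF that(2)] finite_subset by blast
      have "C = {y \<in> C - {b, x}. P y} \<union> {y \<in> C. \<not> P y} \<union> (C \<inter> {b, x})" by blast
      then have "card C \<le> card ({y \<in> C - {b, x}. P y} \<union> {y \<in> C. \<not> P y}) + card (C \<inter> {b, x})"
        by (metis card_Un_le)
      also have "\<dots> \<le> card {y \<in> C - {b, x}. P y} + card {y \<in> C. \<not> P y} + card (C \<inter> {b, x})"
        using card_Un_le by simp
      also have "card (C \<inter> {b, x}) \<le> 2"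
        using card_mono[of "{b, x}" "C \<inter> {b, x}"] by (simp add: card_insert_if split: if_splits)
      finally have "card C \<le> card {y \<in> C - {b, x}. P y} + card {y \<in> C. \<not> P y} + 2" by simp
      moreover have "R \<le> 2 * card C + 1" using finD1(2)[OF that(2)] that(3) by linarith
      ultimately show ?thesis using that(4) K(1) by (simp add: R_def q_def)
    qed
    have core: "layered_blocks (int p) K s q D2 Z (C0 - {b, x}) (C1 - {b, x})"
    proof
      show "K > 0" "s \<ge> 2" by fact+
      show "dissociated (int p) (D2 i)" if "i < s" for i
        using D(1) that dissociated_subset[of p "D i" "D2 i"] by (auto simp: D2_def)
      show "D2 i \<inter> D2 j = {}" if "i < s" "j < s" "i \<noteq> j" for i j by (rule D2dis[OF that])
      show "2 ^ 20 * K \<le> card (D2 i)" if "i < s" for i using cardD2(2)[OF that] K(1) by (simp add: R)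
      show "card (D2 i) \<le> 16 * q" if "i < s" for i using cardD2(1)[OF that] by (simp add: R_def)
      show "q + 5 * K + 1 \<le> card (D2 i)" if "i < s" for i using cardD2(2)[OF that] K(1) by (simp add: R_def q_def)
      show "finite Z" using finF by (simp add: Z_def)
      show "\<not> int p dvd (\<Sum>i<s. \<Sum>(D2 i))"
        using xU(3) dvd_diff_commute[of "int p" "t - b" x] unfolding T0 by (simp add: cong_iff_dvd_diff)
      show "\<not> [(\<Sum>i<s. \<Sum>(D2 i)) = z] (mod int p)" if zZ: "z \<in> Z" for z
      proof
        obtain f where f: "f \<in> F" "z = - b - f" using zZ by (auto simp: Z_def)
        assume "[(\<Sum>i<s. \<Sum>(D2 i)) = z] (mod int p)"
        then have "[t - b - x = - b - f] (mod int p)" unfolding T0 f .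
        then have "[f = - t + x] (mod int p)" by (simp add: cong_iff_dvd_diff) (metis add.commute add_diff_eq diff_diff_eq2 dvd_minus_iff minus_diff_eq uminus_add_conv_diff)
        then show False using box_cong Fbox[OF f(1)] x0 by blast
      qed
      show "C0 - {b, x} \<subseteq> D2 0" using C0(1) by (auto simp: D1_def D2_def)
      show "C1 - {b, x} \<subseteq> D2 (s - 1)" using C1(1) by (auto simp: D1_def D2_def)
      show "q + 5 * K + 1 \<le> card {y \<in> C0 - {b, x}. \<forall>z\<in>Z. \<not> [\<Sum>S + y = z] (mod int p)}"
        if S: "S \<subseteq> C0 - {b, x}" "card S < K" for S
      proof (rule cluster_room[OF C0(1) _ C0(2)])
        have "{y \<in> C0. \<not> (\<forall>z\<in>Z. \<not> [\<Sum>S + y = z] (mod int p))} \<subseteq> {y \<in> C0. 0 + b + \<Sum>S + y \<in> box p B1 N}"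
        proof
          fix y assume "y \<in> {y \<in> C0. \<not> (\<forall>z\<in>Z. \<not> [\<Sum>S + y = z] (mod int p))}"
          then obtain f where y: "y \<in> C0" "f \<in> F" "[\<Sum>S + y = - b - f] (mod int p)" by (auto simp: Z_def)
          then have "[- f = 0 + b + \<Sum>S + y] (mod int p)"
            using cong_add[OF cong_refl[of b] cong_sym[OF y(3)]] by (simp add: algebra_simps)
          then show "y \<in> {y \<in> C0. 0 + b + \<Sum>S + y \<in> box p B1 N}"
            using box_cong box_uminus Fbox[OF y(2)] y(1) by blast
        qed
        then have "card {y \<in> C0. \<not> (\<forall>z\<in>Z. \<not> [\<Sum>S + y = z] (mod int p))} \<le> card {y \<in> C0. 0 + b + \<Sum>S + y \<in> box p B1 N}"
          using finite_subset[OF C0(1) finD1(1)] s by (intro card_mono) auto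
        then show "2 * card {y \<in> C0. \<not> (\<forall>z\<in>Z. \<not> [\<Sum>S + y = z] (mod int p))} \<le> card C0"
          using C0'[of S] S by force
      qed (use s in simp)
      show "q + 5 * K + 1 \<le> card {y \<in> C1 - {b, x}. \<forall>z\<in>Z. \<not> [(\<Sum>i<s. \<Sum>(D2 i)) - (\<Sum>S + y) = z] (mod int p)}"
        if S: "S \<subseteq> C1 - {b, x}" "card S < K" for S
      proof (rule cluster_room[OF C1(1) _ C1(2)])
        have "{y \<in> C1. \<not> (\<forall>z\<in>Z. \<not> [(\<Sum>i<s. \<Sum>(D2 i)) - (\<Sum>S + y) = z] (mod int p))} \<subseteq> {y \<in> C1. - t + x + \<Sum>S + y \<in> box p B1 N}"
        proof
          fix y assume "y \<in> {y \<in> C1. \<not> (\<forall>z\<in>Z. \<not> [(\<Sum>i<s. \<Sum>(D2 i)) - (\<Sum>S + y) = z] (mod int p))}"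
          then obtain f where y: "y \<in> C1" "f \<in> F" "[t - b - x - (\<Sum>S + y) = - b - f] (mod int p)" unfolding T0 by (auto simp: Z_def)
          have "[f = - t + x + \<Sum>S + y] (mod int p)"
          proof -
            have "(t - b - x - (\<Sum>S + y)) - (- b - f) = f - (- t + x + \<Sum>S + y)" by simp
            then show ?thesis using y(3) by (simp only: cong_iff_dvd_diff)
          qed
          then show "y \<in> {y \<in> C1. - t + x + \<Sum>S + y \<in> box p B1 N}"
            using box_cong Fbox[OF y(2)] y(1) by blast
        qed
        then have "card {y \<in> C1. \<not> (\<forall>z\<in>Z. \<not> [(\<Sum>i<s. \<Sum>(D2 i)) - (\<Sum>S + y) = z] (mod int p))} \<le> card {y \<in> C1. - t + x + \<Sum>S + y \<in> box p B1 N}"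
          using finite_subset[OF C1(1) finD1(1)] s by (intro card_mono) auto
        then show "2 * card {y \<in> C1. \<not> (\<forall>z\<in>Z. \<not> [(\<Sum>i<s. \<Sum>(D2 i)) - (\<Sum>S + y) = z] (mod int p))} \<le> card C1"
          using C1'[of S] S by force
      qed (use s in simp)
      have "card Z \<le> n + 1" using card_image_le[OF finF(1), of "\<lambda>f. - b - f"] finF(2) unfolding Z_def by linarith
      then have "card Z + 1 \<le> 2 ^ K" "(\<Sum>i<s. card (D2 i)) \<le> 2 ^ K"
        using sumcard K(2) unfolding n_def by linarith+
      then have "(\<Sum>i<s. card (D2 i))\<^sup>2 * (card Z + 1) \<le> (2 ^ K)\<^sup>2 * 2 ^ K"
        by (intro mult_le_mono power_mono) simp_all
      also have "\<dots> = (2::nat) ^ (K * 2 + K)" by (simp only: power_mult power_add)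
      also have "\<dots> < 2 ^ (4 * K)" using K(1) by (intro power_strict_increasing) simp_all
      also have "\<dots> = (2 ^ 4) ^ K" by (rule power_mult)
      also have "(2::nat) ^ 4 = 16" by simp
      finally show "(\<Sum>i<s. card (D2 i))\<^sup>2 * (card Z + 1) < 16 ^ K" .
    qed
    from layered_blocks.good_word_exists[OF core] obtain w where w: "distinct w" "set w = U1 - {b, x}"
      and w34: "\<forall>i j. i < j \<longrightarrow> j \<le> length w \<longrightarrow> \<not> [sum_list (take j w) - sum_list (take i w) = 0] (mod int p)"
        "\<forall>j. 0 < j \<longrightarrow> j \<le> length w \<longrightarrow> (\<forall>z\<in>Z. \<not> [sum_list (take j w) = z] (mod int p))"
      unfolding D2un by (elim exE conjE) (rule that)
    note w3 = w34(1)[rule_format] and w4 = w34(2)[rule_format]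
    \<comment> \<open>Once \<open>x\<close> is put in front, intervals starting at the first element
      of \<open>ys\<close> are compared as well, so every nonempty interval of \<open>ys\<close>,
      the whole list included, must have nonzero sum.\<close>
    define ys where "ys = es @ [b] @ w"
    have ys_diff: "\<not> int p dvd sum_list (take j ys) - sum_list (take i ys)" if ij: "i < j" "j \<le> length ys" for i j
    proof -
      define e where "e = length es"
      have S1: "sum_list (take k ys) = sum_list (take k es)" if "k \<le> e" for k
        using that by (simp add: ys_def e_def)
      have S2: "sum_list (take k ys) = sum_list es + b + sum_list (take (k - e - 1) w)" if k: "e < k" for k
      proof -
        obtain d where "k = e + Suc d" using k less_imp_Suc_add by fastforce
        then show ?thesis by (simp add: ys_def e_def)
      qed
      consider "j \<le> e" | "i \<le> e" "e < j" | "e < i" using ij by linarith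
      then show ?thesis
      proof cases
        case 1
        then show ?thesis using es_diff[OF ij(1)] ij S1 by (simp add: e_def)
      next
        case 2
        define f where "f = sum_list (drop i es)"
        have f: "f \<in> F" using 2(1) by (auto simp: f_def F_def e_def)
        have eq: "sum_list (take j ys) - sum_list (take i ys) = f + b + sum_list (take (j - e - 1) w)"
          using S1[OF 2(1)] S2[OF 2(2)] sum_list_drop_eq[of i es] by (simp add: f_def)
        show ?thesis
        proof
          assume "int p dvd sum_list (take j ys) - sum_list (take i ys)"
          then have d: "int p dvd f + b + sum_list (take (j - e - 1) w)" unfolding eq .
          show False
          proof (cases "j - e - 1 = 0")
            case True
            then have "[- f = 0 + b] (mod int p)"
              using d by (simp add: cong_iff_dvd_diff) (metis dvd_minus_iff minus_add_distrib uminus_add_conv_diff add.commute)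
            then show False using box_cong box_uminus Fbox[OF f] b0 by blast
          next
            case False
            have "[sum_list (take (j - e - 1) w) = - b - f] (mod int p)"
            proof -
              have "sum_list (take (j - e - 1) w) - (- b - f) = f + b + sum_list (take (j - e - 1) w)" by simp
              then show ?thesis using d by (simp only: cong_iff_dvd_diff)
            qed
            moreover have "- b - f \<in> Z" using f by (simp add: Z_def)
            moreover have "j - e - 1 \<le> length w" using ij(2) by (simp add: ys_def e_def)
            ultimately show False using w4[of "j - e - 1"] False by blast
          qed
        qed
      next
        case 3
        have "sum_list (take j ys) - sum_list (take i ys) = sum_list (take (j - e - 1) w) - sum_list (take (i - e - 1) w)"
          using S2[OF 3] S2[of j] 3 ij(1) by simp
        moreover have "i - e - 1 < j - e - 1" "j - e - 1 \<le> length w" using 3 ij by (auto simp: ys_def e_def)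
        ultimately show ?thesis using w3[of "i - e - 1" "j - e - 1"] by (simp add: cong_0_iff)
      qed
    qed
    have "separating_order p A (x # ys)"
      unfolding separating_order_def
    proof (intro conjI allI impI)
      show "distinct (x # ys)" using es(1,2) w(1,2) AEU(2) b xU by (auto simp: ys_def)
      show "set (x # ys) = A" using es(2) w(2) AEU(1) b xU by (auto simp: ys_def)
      fix i j assume ij: "0 < i" "i < j" "j \<le> length (x # ys)"
      then obtain i' j' where "i = Suc i'" "j = Suc j'" by (metis gr0_implies_Suc less_trans)
      then show "\<not> int p dvd sum_list (take j (x # ys)) - sum_list (take i (x # ys))" using ys_diff[of i' j'] ij by simp
    qed
    then show ?thesis by blast
  qed
qed

section \<open>Transfer to the residue ring and choice of parameters\<close>

lemma partial_sum_residue_ring: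
  assumes "m > 1" "set xs \<subseteq> carrier (residue_ring m)" "k \<le> length xs"
  shows "partial_sum (residue_ring m) xs k = sum_list (take k xs) mod m"
proof -
  interpret residues m "residue_ring m" by unfold_locales (use assms(1) in simp_all)
  have "xs ! i \<in> carrier (residue_ring m)" if "i < length xs" for i
    using assms(2) that by (meson nth_mem subsetD)
  with assms(3) show ?thesis
  proof (induction k)
    case 0
    then show ?case by (simp add: partial_sum_def res_zero_eq)
  next
    case (Suc k)
    have "partial_sum (residue_ring m) xs (Suc k) = xs ! k \<oplus>\<^bsub>residue_ring m\<^esub> partial_sum (residue_ring m) xs k"
      unfolding partial_sum_def lessThan_Suc using Suc.prems by (intro finsum_insert) auto
    also have "\<dots> = (xs ! k + sum_list (take k xs) mod m) mod m" using Suc by (simp add: res_add_eq)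
    also have "\<dots> = sum_list (take (Suc k) xs) mod m"
      using Suc.prems(1) by (simp add: take_Suc_conv_app_nth mod_add_right_eq add.commute)
    finally show ?case .
  qed
qed

lemma separating_order_valid:
  assumes "p > 1" "A \<subseteq> carrier (residue_ring p)" "separating_order p A xs"
  shows "valid_ordering (residue_ring p) A xs"
proof -
  have xs: "distinct xs" "set xs = A"
    using assms(3) unfolding separating_order_def by auto
  have sep: "\<not> p dvd sum_list (take j xs) - sum_list (take i xs)" if "0 < i" "i < j" "j \<le> length xs" for i j
    using assms(3) that unfolding separating_order_def by blast
  have "inj_on (partial_sum (residue_ring p) xs) {1..length xs}"
  proof (rule linorder_inj_onI)
    fix i j assume ij: "i < j" "i \<in> {1..length xs}" "j \<in> {1..length xs}"
    then have "sum_list (take j xs) mod p \<noteq> sum_list (take i xs) mod p"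
      using sep[of i j] by (auto simp: mod_eq_dvd_iff)
    then show "partial_sum (residue_ring p) xs i \<noteq> partial_sum (residue_ring p) xs j"
      using ij xs(2) assms(1,2) by (simp add: partial_sum_residue_ring)
  qed auto
  then show ?thesis using xs by (simp add: valid_ordering_def)
qed

text \<open>With \<open>K\<close> about \<open>log 2 (card A)\<close> and
  \<open>Q = 2 ^ (26 * K)\<close>, rectification asks for
  \<open>26 * 2 ^ 22 * K ^ 2 * ln 2 < ln p\<close>. As
  \<open>K \<le> 3 + d * ln p powr (1/4)\<close>, the left side is at most of the order of the
  square root of \<open>ln p\<close>.\<close>

lemma separating_order_subexponential:
  fixes c :: real
  assumes "c > 0"
  shows "\<exists>p0 :: nat. \<forall>p \<ge> p0. prime p \<longrightarrow> (\<forall>A. A \<subseteq> {1..<int p} \<longrightarrow>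
    real (card A) \<le> exp (c * ln (real p) powr (1/4)) \<longrightarrow> (\<exists>xs. separating_order p A xs))"
proof -
  \<comment> \<open>Change of base: \<open>exp (c * y) = 2 powr (d * y)\<close>.\<close>
  define d where "d = c / ln 2"
  have d: "d > 0" using assms by (simp add: d_def)
  have "eventually (\<lambda>x::real. 26 * 2 ^ 22 * (3 + d * ln x powr (1/4)) ^ 2 * ln 2 < ln x) at_top"
    using d by real_asymp
  then have "eventually (\<lambda>p::nat. 26 * 2 ^ 22 * (3 + d * ln (real p) powr (1/4)) ^ 2 * ln 2 < ln (real p)) sequentially"
    using filterlim_real_sequentially by (rule eventually_compose_filterlim)
  then obtain p0 where p0: "\<And>p. p \<ge> p0 \<Longrightarrow> 26 * 2 ^ 22 * (3 + d * ln (real p) powr (1/4)) ^ 2 * ln 2 < ln (real p)"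
    unfolding eventually_sequentially by blast
  show ?thesis
  proof (intro exI[of _ p0] allI impI)
    fix p A assume p: "p0 \<le> p" "prime p" and A: "A \<subseteq> {1..<int p}" and small: "real (card A) \<le> exp (c * ln (real p) powr (1/4))"
    define n where "n = card A"
    define y where "y = ln (real p) powr (1/4)"
    have y: "y \<ge> 0" by (simp add: y_def)
    define K where "K = nat \<lceil>log 2 (real (n + 2))\<rceil>"
    have log1: "log 2 (real (n + 2)) \<ge> 1"
      by (subst le_log_iff) auto
    have K1: "K > 0" and Klog: "log 2 (real (n + 2)) \<le> real K" "real K \<le> log 2 (real (n + 2)) + 1"
      using log1 unfolding K_def by linarith+
    have nK: "n + 2 \<le> 2 ^ K"
    proof -
      have "real (n + 2) \<le> 2 powr real K" using Klog(1) by (subst (asm) log_le_iff) auto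
      then have "real (n + 2) \<le> real (2 ^ K)" by (simp add: powr_realpow)
      then show ?thesis by (simp only: of_nat_le_iff)
    qed
    have "1 \<le> exp (c * y)" using assms y by simp
    then have "real (n + 2) \<le> 4 * exp (c * y)" using small unfolding n_def y_def of_nat_add by linarith
    then have "log 2 (real (n + 2)) \<le> log 2 (4 * exp (c * y))" by (subst log_le_cancel_iff) auto
    also have "\<dots> = 2 + d * y" by (simp add: log_def ln_mult d_def field_simps ln_realpow[of 2 2, simplified])
    finally have Ky: "real K \<le> 3 + d * y" using Klog(2) by linarith
    have "(2::real) ^ (26 * 2 ^ 22 * K ^ 2) < real p"
    proof -
      have "real (26 * 2 ^ 22 * K ^ 2) * ln 2 \<le> 26 * 2 ^ 22 * (3 + d * y) ^ 2 * ln 2"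
        using Ky by (simp add: power_mono)
      also have "\<dots> < ln (real p)" unfolding y_def by (rule p0[OF p(1)])
      finally have "exp (real (26 * 2 ^ 22 * K ^ 2) * ln 2) < exp (ln (real p))" by simp
      then show ?thesis using prime_gt_0_nat[OF p(2)] by (simp add: powr_realpow[symmetric] powr_def del: of_nat_mult of_nat_power)
    qed
    then have Qp: "(2::int) ^ (26 * 2 ^ 22 * K ^ 2) < int p"
      by (metis of_int_less_iff of_int_numeral of_int_of_nat_eq of_int_power)
    have "K + 1 \<le> 2 ^ K" using K1 by (metis Suc_eq_plus1 Suc_leI less_exp)
    \<comment> \<open>The factors are below \<open>2 ^ K\<close>, at most
      \<open>2 ^ (22 + K)\<close>, and twice at most \<open>2 ^ K\<close>; then
      \<open>22 + 4 * K \<le> 26 * K\<close> gives the exponent 26.\<close>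
    have "int n * int (2 ^ 22 * K) * ((int K + 1) * (int n + 1)) < 2 ^ (26 * K)"
    proof -
      have "n * (2 ^ 22 * K) * ((K + 1) * (n + 1)) \<le> n * (2 ^ 22 * 2 ^ K) * (2 ^ K * 2 ^ K)"
        using nK \<open>K + 1 \<le> 2 ^ K\<close> by (intro mult_le_mono) simp_all
      also have "\<dots> < 2 ^ K * (2 ^ 22 * 2 ^ K) * (2 ^ K * 2 ^ K)"
        using nK by (intro mult_strict_right_mono) simp_all
      also have "\<dots> = 2 ^ (K + (22 + K) + (K + K))" by (simp only: power_add)
      also have "\<dots> \<le> 2 ^ (26 * K)" using K1 by (intro power_increasing) simp_all
      finally have "int (n * (2 ^ 22 * K) * ((K + 1) * (n + 1))) < int (2 ^ (26 * K))" by (simp only: of_nat_less_iff)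
      then show ?thesis by (simp only: of_nat_mult of_nat_add of_nat_1 of_nat_power of_nat_numeral)
    qed
    moreover have "((2::int) ^ (26 * K)) ^ (2 ^ 22 * K) = 2 ^ (26 * 2 ^ 22 * K ^ 2)"
      unfolding power_mult[symmetric] by (simp add: power2_eq_square)
    ultimately show "\<exists>xs. separating_order p A xs"
      using Qp nK K1 by (intro separating_order_exists[OF p(2) A, of K "2 ^ (26 * K)"]) (simp_all only: n_def)
  qed
qed

theorem theorem1p2:
  fixes c :: real
  assumes "c > 0"
  shows "\<exists>p0 :: nat. \<forall>p :: nat. prime p \<and> p \<ge> p0 \<longrightarrow>
    (\<forall>A. A \<subseteq> carrier (residue_ring (int p)) - {\<zero>\<^bsub>residue_ring (int p)\<^esub>} \<and>
         real (card A) \<le> exp (c * ln (real p) powr (1/4)) \<longrightarrow>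
         (\<exists>xs. valid_ordering (residue_ring (int p)) A xs))"
proof -
  obtain p0 :: nat where p0: "\<forall>p \<ge> p0. prime p \<longrightarrow> (\<forall>A. A \<subseteq> {1..<int p} \<longrightarrow>
    real (card A) \<le> exp (c * ln (real p) powr (1/4)) \<longrightarrow> (\<exists>xs. separating_order p A xs))"
    using separating_order_subexponential[OF assms] by blast
  show ?thesis
  proof (intro exI[of _ p0] allI impI, elim conjE)
    fix p A assume p: "prime p" "p0 \<le> p"
      and A: "A \<subseteq> carrier (residue_ring (int p)) - {\<zero>\<^bsub>residue_ring (int p)\<^esub>}"
      and small: "real (card A) \<le> exp (c * ln (real p) powr (1/4))"
    have p1: "int p > 1" using prime_gt_1_nat[OF p(1)] by simp
    have "A \<subseteq> {1..<int p}" using A by (force simp: residue_ring_def)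
    then obtain xs where "separating_order p A xs" using p0 p small by blast
    then show "\<exists>xs. valid_ordering (residue_ring (int p)) A xs"
      using separating_order_valid[OF p1] A by blast
  qed
qed

end
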